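(* Let $I_h$ be a signed Choquet integral with representation $I_h(X)=\int_0^1\gamma(u)F_X^{-1}(u)\,du$ and distortion weight function $\gamma$. Let $\phi:\mathbb{R}\to\mathbb{R}$ be a strictly convex Bregman generator satisfying $\lim_{x\to\infty}\phi'(x)=\infty$ and $\lim_{x\to-\infty}\phi'(x)=-\infty$. Let $F$ be a reference cdf on $\mathbb{R}$ and $\epsilon>0$. Assume at least one of the following holds: (i) $\gamma$ is non-decreasing; (ii) $\gamma$ is non-negative and $\int_0^1\big(\phi'(F^{-1}(u))^2+\gamma(u)^2\big)\,du<\infty$. Consider the problem $$\max_{\{G^{-1}\,:\,G\in\mathcal{M}_p(\mathbb{R})\}}\tilde I_h(G^{-1})\quad\text{subject to}\quad\mathcal{B}_\phi(G^{-1},F^{-1})\le\epsilon.$$ Then the quantile function attaining the maximum (the worst-case quantile function), if it exists, is unique and given by $$G^{-1}_{\lambda^*}(u)=(\phi')^{-1}\left(\Big(\phi'\big(F^{-1}(u)\big)+\frac1{\lambda^*}\gamma(u)\Big)^{\uparrow}\right),$$ where $G^{-1}_\lambda$ denotes the same expression with $\lambda$ in place of $\lambda^*$, and $\lambda^*>0$ is the smallest solution to $\mathcal{B}_\phi(G^{-1}_\lambda,F^{-1})=\epsilon$ in case (i) and the unique solution to $\mathcal{B}_\phi(G^{-1}_\lambda,F^{-1})=\epsilon$ in case (ii).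
   Context: $F^{-1}(\alpha)=\inf\{x\in\mathbb{R}:F(x)\ge\alpha\}$, $\alpha\in(0,1)$, is the left-continuous quantile function. $\mathcal{M}_p(\mathbb{R})$ is the set of cdfs on $\mathbb{R}$ with finite $p$-th absolute moment; $p\ge1$ is chosen such that the divergence constraint is well defined (e.g. $p=2$ for $\phi(x)=x^2$). A signed Choquet integral is $I_h(X)=\int_{-\infty}^0[h(\mathbb{P}(X\ge x))-h(1)]\,dx+\int_0^\infty h(\mathbb{P}(X\ge x))\,dx$, where the distortion function $h:[0,1]\to\mathbb{R}$ is non-constant, of bounded variation, with $h(0)=0$; $I_h(X)$ is assumed finite for the $X$ considered. When $h$ is absolutely continuous, $I_h(X)=\int_0^1\gamma(u)F_X^{-1}(u)\,du$ with distortion weight function $\gamma(u)$ equal to the left derivative of $h$ at $1-u$. $\tilde I_h(F_X^{-1})=I_h(X)$. A Bregman generator is a convex differentiable function $\phi$, with $B_\phi(z_1,z_2)=\phi(z_1)-\phi(z_2)-\phi'(z_2)(z_1-z_2)$; the univariate Bregman-Wasserstein divergence is $\mathcal{B}_\phi(G^{-1},F^{-1})=\mathcal{B}_\phi[G,F]=\int_0^1B_\phi(G^{-1}(t),F^{-1}(t))\,dt$. The isotonic projection of $\ell\in\mathcal{L}^2((0,1))$ is $\ell^\uparrow=\arg\min_{j\in\mathcal{K}}\int_0^1(j(u)-\ell(u))^2du$, where $\mathcal{K}$ is the set of left-continuous non-decreasing square-integrable functions on $(0,1)$. In case (i), $\phi'(F^{-1}(u))+\frac1\lambda\gamma(u)$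 is non-decreasing and equals its own isotonic projection, so $\uparrow$ may be omitted there. *)

theory Defs
  imports "HOL-Probability.Probability"
begin

section \<open>Distribution functions and quantile functions\<close>

definition is_cdf :: "(real \<Rightarrow> real) \<Rightarrow> bool" where
  "is_cdf F \<longleftrightarrow> (\<exists>M. real_distribution M \<and> F = cdf M)"

definition moment_cdfs :: "real \<Rightarrow> (real \<Rightarrow> real) set" where
  "moment_cdfs p = {cdf M | M. real_distribution M \<and> integrable M (\<lambda>x. \<bar>x\<bar> powr p)}"

text \<open>Only the values at arguments strictly between 0 and 1 are meaningful.\<close>

definition quantile :: "(real \<Rightarrow> real) \<Rightarrow> real \<Rightarrow> real" where
  "quantile F \<alpha> = Inf {x. F x \<ge> \<alpha>}"

text \<open>The uniform probability space on the open unit interval. It carries Lebesgue rather than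
  Borel sets because a weight function is determined by its distortion function only up to a
  null set.\<close>

abbreviation unif :: "real measure" where
  "unif \<equiv> lebesgue_on {0<..<1}"


section \<open>Signed Choquet integrals\<close>

definition bounded_variation_on :: "real \<Rightarrow> real \<Rightarrow> (real \<Rightarrow> real) \<Rightarrow> bool" where
  "bounded_variation_on a b f \<longleftrightarrow>
     (\<exists>V. \<forall>n (t :: nat \<Rightarrow> real).
        (\<forall>i\<le>n. t i \<in> {a..b}) \<and> (\<forall>i<n. t i \<le> t (Suc i)) \<longrightarrow>
        (\<Sum>i<n. \<bar>f (t (Suc i)) - f (t i)\<bar>) \<le> V)"

definition distortion :: "(real \<Rightarrow> real) \<Rightarrow> bool" where
  "distortion h \<longleftrightarrow> h 0 = 0 \<and> bounded_variation_on 0 1 h \<and> \<not> h constant_on {0..1}"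

definition upper_prob :: "'a measure \<Rightarrow> ('a \<Rightarrow> real) \<Rightarrow> real \<Rightarrow> real" where
  "upper_prob M X x = measure M {\<omega> \<in> space M. X \<omega> \<ge> x}"

definition signed_choquet :: "(real \<Rightarrow> real) \<Rightarrow> 'a measure \<Rightarrow> ('a \<Rightarrow> real) \<Rightarrow> real" where
  "signed_choquet h M X =
     (LINT x:{..0}|lborel. h (upper_prob M X x) - h 1) + (LINT x:{0..}|lborel. h (upper_prob M X x))"

definition choquet_finite :: "(real \<Rightarrow> real) \<Rightarrow> 'a measure \<Rightarrow> ('a \<Rightarrow> real) \<Rightarrow> bool" where
  "choquet_finite h M X \<longleftrightarrow>
     set_integrable lborel {..0} (\<lambda>x. h (upper_prob M X x) - h 1) \<and>
     set_integrable lborel {0..} (\<lambda>x. h (upper_prob M X x))"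

text \<open>The functional on quantile functions induced by a signed Choquet integral, which depends on
  a random variable only through its law: a quantile function q, read as a random variable on
  the uniform space, is itself a random variable with quantile function q.\<close>

definition choquet_quantile :: "(real \<Rightarrow> real) \<Rightarrow> (real \<Rightarrow> real) \<Rightarrow> real" where
  "choquet_quantile h q = signed_choquet h unif q"

definition distortion_weight :: "(real \<Rightarrow> real) \<Rightarrow> (real \<Rightarrow> real) \<Rightarrow> bool" where
  "distortion_weight h \<gamma> \<longleftrightarrow> (AE u in unif. (h has_real_derivative \<gamma> u) (at_left (1 - u)))"

definition weight_representation ::
    "real \<Rightarrow> (real \<Rightarrow> real) \<Rightarrow> (real \<Rightarrow> real) \<Rightarrow> bool" where
  "weight_representation p h \<gamma> \<longleftrightarrow>
     (\<forall>G \<in> moment_cdfs p. choquet_finite h unif (quantile G) \<longrightarrow>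
        integrable unif (\<lambda>u. \<gamma> u * quantile G u) \<and>
        choquet_quantile h (quantile G) = (\<integral>u. \<gamma> u * quantile G u \<partial>unif))"


section \<open>Bregman--Wasserstein divergence\<close>

definition strictly_convex :: "(real \<Rightarrow> real) \<Rightarrow> bool" where
  "strictly_convex \<phi> \<longleftrightarrow>
     (\<forall>x y t. x \<noteq> y \<and> 0 < t \<and> t < 1 \<longrightarrow>
        \<phi> ((1 - t) * x + t * y) < (1 - t) * \<phi> x + t * \<phi> y)"

definition strict_bregman_generator :: "(real \<Rightarrow> real) \<Rightarrow> bool" where
  "strict_bregman_generator \<phi> \<longleftrightarrow> strictly_convex \<phi> \<and> (\<forall>x. \<phi> differentiable (at x))"

definition bregman :: "(real \<Rightarrow> real) \<Rightarrow> real \<Rightarrow> real \<Rightarrow> real" where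
  "bregman \<phi> z1 z2 = \<phi> z1 - \<phi> z2 - deriv \<phi> z2 * (z1 - z2)"

text \<open>The integrand is non-negative for convex generators, so the divergence is always defined
  with values in the extended non-negative reals.\<close>

definition bw_div :: "(real \<Rightarrow> real) \<Rightarrow> (real \<Rightarrow> real) \<Rightarrow> (real \<Rightarrow> real) \<Rightarrow> ennreal" where
  "bw_div \<phi> g f = (\<integral>\<^sup>+u. ennreal (bregman \<phi> (g u) (f u)) \<partial>unif)"


section \<open>Isotonic projection\<close>

definition isotonic_cone :: "(real \<Rightarrow> real) set" where
  "isotonic_cone =
     {j. mono_on {0<..<1} j \<and> (\<forall>u\<in>{0<..<1}. continuous (at_left u) j) \<and>
         integrable unif (\<lambda>u. (j u)\<^sup>2)}"

text \<open>For square-integrable arguments the minimiser exists and is unique on the open unit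
  interval; its values elsewhere are irrelevant.\<close>

definition isotonic_proj :: "(real \<Rightarrow> real) \<Rightarrow> real \<Rightarrow> real" where
  "isotonic_proj l = arg_min_on (\<lambda>j. \<integral>u. (j u - l u)\<^sup>2 \<partial>unif) isotonic_cone"


section \<open>The worst-case problem\<close>

definition feasible ::
    "real \<Rightarrow> (real \<Rightarrow> real) \<Rightarrow> (real \<Rightarrow> real) \<Rightarrow> real \<Rightarrow> (real \<Rightarrow> real) \<Rightarrow> bool" where
  "feasible p \<phi> F \<epsilon> q \<longleftrightarrow>
     q \<in> quantile ` moment_cdfs p \<and> bw_div \<phi> q (quantile F) \<le> ennreal \<epsilon>"

definition worst_case_quantile ::
    "real \<Rightarrow> (real \<Rightarrow> real) \<Rightarrow> (real \<Rightarrow> real) \<Rightarrow> (real \<Rightarrow> real) \<Rightarrow> real \<Rightarrow> (real \<Rightarrow> real) \<Rightarrow> bool" where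
  "worst_case_quantile p h \<phi> F \<epsilon> q \<longleftrightarrow> is_arg_max (choquet_quantile h) (feasible p \<phi> F \<epsilon>) q"

definition tilted :: "(real \<Rightarrow> real) \<Rightarrow> (real \<Rightarrow> real) \<Rightarrow> (real \<Rightarrow> real) \<Rightarrow> real \<Rightarrow> real \<Rightarrow> real" where
  "tilted \<phi> F \<gamma> lam u = deriv \<phi> (quantile F u) + 1 / lam * \<gamma> u"

text \<open>The candidate without projection, for non-decreasing weights (where the argument need not be
  square-integrable), and with projection.\<close>

definition cand_mono :: "(real \<Rightarrow> real) \<Rightarrow> (real \<Rightarrow> real) \<Rightarrow> (real \<Rightarrow> real) \<Rightarrow> real \<Rightarrow> real \<Rightarrow> real" where
  "cand_mono \<phi> F \<gamma> lam u = inv (deriv \<phi>) (tilted \<phi> F \<gamma> lam u)"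

definition cand_proj :: "(real \<Rightarrow> real) \<Rightarrow> (real \<Rightarrow> real) \<Rightarrow> (real \<Rightarrow> real) \<Rightarrow> real \<Rightarrow> real \<Rightarrow> real" where
  "cand_proj \<phi> F \<gamma> lam u = inv (deriv \<phi>) (isotonic_proj (tilted \<phi> F \<gamma> lam) u)"

end

theory Submission
  imports Defs
begin

text \<open>The problem maximises a linear functional \<open>gain\<close> over a convex set of monotone functions under a
  convex constraint \<open>divg \<le> \<epsilon>\<close>. Separating the image of the admissible functions under
  \<open>(gain, divg)\<close> from the set of better feasible values in the plane gives multipliers
  \<open>a, b \<ge> 0\<close>, not both zero, such that an optimiser \<open>q\<close> maximises \<open>a gain - b divg\<close> over all admissible
  functions. No constraint qualification is needed: degenerate multipliers are excluded afterwards,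
  \<open>b = 0\<close> because it would force \<open>\<gamma> = 0\<close>, and \<open>a = 0\<close> because it would force \<open>q = F\<^sup>-\<^sup>1\<close>, where the
  divergence vanishes.

  The stationarity condition is tested only with perturbations that raise \<open>q\<close> towards a constant \<open>c\<close> on an
  upper interval, or lower it towards \<open>c\<close> on a lower interval. They keep monotonicity, and by convexity the
  divergence stays finite although \<open>q\<close> and \<open>F\<^sup>-\<^sup>1\<close> may be unbounded. If \<open>a \<gamma> + b \<phi>' \<circ> F\<^sup>-\<^sup>1\<close> is monotone,
  they already give \<open>b \<phi>'(q) = a \<gamma> + b \<phi>'(F\<^sup>-\<^sup>1)\<close>. In general, with \<open>K = \<phi>'(F\<^sup>-\<^sup>1) + (a / b) \<gamma>\<close> and its
  projection \<open>k\<close>, one perturbs on the level sets \<open>{k > m}\<close> and \<open>{k < m}\<close>, where minimality of \<open>k\<close> says that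
  \<open>K - m\<close> integrates non-negatively (non-positively) against decreasing (increasing) weights; hence
  \<open>\<phi>'(q) = k\<close>.

  The multiplier is unique since the divergence of the candidate is strictly monotone in it; with the
  projection this uses that isotonic projection preserves order and means. The optimiser is unique
  because the midpoint of two optimisers would be an optimiser with slack constraint.\<close>

section \<open>Bregman generators\<close>

lemma strictly_convex_imp_convex_on:
  assumes "strictly_convex \<phi>"
  shows "convex_on UNIV \<phi>"
proof (rule convex_onI)
  fix t x y :: real
  assume "0 < t" "t < 1"
  then show "\<phi> ((1 - t) *\<^sub>R x + t *\<^sub>R y) \<le> (1 - t) * \<phi> x + t * \<phi> y"
    using assms[unfolded strictly_convex_def, rule_format, of x y t]
    by (cases "x = y") (auto simp: algebra_simps)
qed simp

text \<open>The two limits of the derivative make it surjective. With strict monotonicity this turns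
  \<open>\<psi>\<close> into a two-sided inverse of \<open>d\<close>, not just a choice of
  preimages.\<close>

locale bregman_generator =
  fixes \<phi> :: "real \<Rightarrow> real"
  assumes strict_generator: "strict_bregman_generator \<phi>"
    and deriv_at_top: "filterlim (deriv \<phi>) at_top at_top"
    and deriv_at_bot: "filterlim (deriv \<phi>) at_bot at_bot"
begin

abbreviation d :: "real \<Rightarrow> real" where "d \<equiv> deriv \<phi>"
abbreviation \<psi> :: "real \<Rightarrow> real" where "\<psi> \<equiv> inv (deriv \<phi>)"

lemma DERIV_d: "(\<phi> has_real_derivative d x) (at x)"
  using strict_generator unfolding strict_bregman_generator_def
  by (simp add: DERIV_deriv_iff_real_differentiable)

lemma strict_convexity:
  "x \<noteq> y \<Longrightarrow> 0 < t \<Longrightarrow> t < 1 \<Longrightarrow> \<phi> ((1 - t) * x + t * y) < (1 - t) * \<phi> x + t * \<phi> y"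
  using strict_generator unfolding strict_bregman_generator_def strictly_convex_def by blast

lemma continuous_generator: "continuous_on A \<phi>"
  using DERIV_d DERIV_isCont continuous_at_imp_continuous_on by blast

lemma tangent_le: "d x * (y - x) \<le> \<phi> y - \<phi> x"
  using convex_on_imp_above_tangent[of UNIV \<phi> x y "d x"] DERIV_d[of x]
    strictly_convex_imp_convex_on strict_generator
  unfolding strict_bregman_generator_def by simp

text \<open>Strictness comes from the midpoint: there \<open>\<phi>\<close> lies strictly below the
  chord but still on or above the tangent at \<open>x\<close>. Doubling the two estimates compares
  chord and tangent at \<open>y\<close>.\<close>

lemma tangent_less:
  assumes "x \<noteq> y"
  shows "d x * (y - x) < \<phi> y - \<phi> x"
proof -
  define m where "m = (1 - 1/2) * x + (1/2) * y"
  have "\<phi> m < (1 - 1/2) * \<phi> x + (1/2) * \<phi> y"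
    unfolding m_def by (rule strict_convexity[OF assms]) simp_all
  moreover have "d x * (m - x) \<le> \<phi> m - \<phi> x" by (rule tangent_le)
  moreover have "d x * (m - x) = d x * (y - x) / 2" by (simp add: m_def field_simps)
  ultimately show ?thesis by simp
qed

lemma strict_mono_d: "strict_mono d"
proof (rule strict_monoI)
  fix x y :: real
  assume "x < y"
  then have "d x * (y - x) < d y * (y - x)"
    using tangent_less[of x y] tangent_less[of y x] by (simp add: algebra_simps)
  with \<open>x < y\<close> show "d x < d y" by simp
qed

lemma d_less_iff [simp]: "d x < d y \<longleftrightarrow> x < y"
  by (rule strict_mono_less[OF strict_mono_d])

lemma d_le_iff [simp]: "d x \<le> d y \<longleftrightarrow> x \<le> y"
  by (rule strict_mono_less_eq[OF strict_mono_d])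

lemma surj_d: "surj d"
proof -
  have "\<exists>x. d x = y" for y
  proof -
    obtain b where b: "d b > y"
      using deriv_at_top filterlim_at_top_dense
      by (metis eventually_happens trivial_limit_at_top_linorder)
    obtain a where a: "d a < y"
      using deriv_at_bot filterlim_at_bot_dense
      by (metis eventually_happens trivial_limit_at_bot_linorder)
    have "d a < d b" using a b by linarith
    then have ab: "a < b" by simp
    have cont: "continuous_on {a..b} (\<lambda>x. \<phi> x - y * x)"
      by (intro continuous_intros continuous_generator)
    then obtain z where z: "z \<in> {a..b}" "\<And>x. x \<in> {a..b} \<Longrightarrow> \<phi> z - y * z \<le> \<phi> x - y * x"
      using continuous_attains_inf[of "{a..b}" "\<lambda>x. \<phi> x - y * x"] ab by auto
    have der: "((\<lambda>x. \<phi> x - y * x) has_real_derivative (d x - y)) (at x)" for x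
      by (auto intro!: derivative_eq_intros DERIV_d)
    have "z \<noteq> a"
    proof
      assume "z = a"
      obtain e where e: "e > 0" "\<And>h. 0 < h \<Longrightarrow> h < e \<Longrightarrow> \<phi> (a + h) - y * (a + h) < \<phi> a - y * a"
        using DERIV_neg_dec_right[OF der[of a]] a by auto
      define h where "h = min (e/2) (b - a)"
      have "0 < h" "h < e" "h \<le> b - a" using e(1) ab by (auto simp: h_def)
      then show False using e(2)[of h] z(2)[of "a + h"] \<open>z = a\<close> by auto
    qed
    moreover have "z \<noteq> b"
    proof
      assume "z = b"
      obtain e where e: "e > 0" "\<And>h. 0 < h \<Longrightarrow> h < e \<Longrightarrow> \<phi> (b - h) - y * (b - h) < \<phi> b - y * b"
        using DERIV_pos_inc_left[OF der[of b]] b by auto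
      define h where "h = min (e/2) (b - a)"
      have "0 < h" "h < e" "h \<le> b - a" using e(1) ab by (auto simp: h_def)
      then show False using e(2)[of h] z(2)[of "b - h"] \<open>z = b\<close> by auto
    qed
    ultimately have "a < z" "z < b" using z(1) by auto
    then have "\<forall>x. \<bar>z - x\<bar> < min (z - a) (b - z) \<longrightarrow> \<phi> z - y * z \<le> \<phi> x - y * x"
      by (intro allI impI z(2)) (auto simp: abs_less_iff)
    then have "d z - y = 0"
      using DERIV_local_min[OF der[of z], of "min (z - a) (b - z)"] \<open>a < z\<close> \<open>z < b\<close> by auto
    then show ?thesis by auto
  qed
  then show ?thesis by (metis surjI surj_def)
qed

lemma d_\<psi> [simp]: "d (\<psi> y) = y"
  by (rule surj_f_inv_f[OF surj_d])

lemma \<psi>_d [simp]: "\<psi> (d x) = x"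
  by (simp add: inv_f_f strict_mono_imp_inj_on[OF strict_mono_d])

lemma \<psi>_less_iff [simp]: "\<psi> x < \<psi> y \<longleftrightarrow> x < y"
  by (metis d_\<psi> d_less_iff)

lemma \<psi>_le_iff [simp]: "\<psi> x \<le> \<psi> y \<longleftrightarrow> x \<le> y"
  by (metis d_\<psi> d_le_iff)

text \<open>A monotone function with open range cannot jump, so surjectivity yields continuity of
  the derivative. The same reasoning serves for \<open>\<psi>\<close>.\<close>

lemma continuous_d: "continuous_on UNIV d"
  by (rule continuous_onI_mono) (simp_all add: surj_d)

lemma continuous_\<psi>: "continuous_on UNIV \<psi>"
proof (rule continuous_onI_mono)
  have "range \<psi> = UNIV" by (metis \<psi>_d surjI)
  then show "open (range \<psi>)" by simp
qed simp

lemma measurable_generator [measurable]: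
  "\<phi> \<in> borel_measurable borel" "d \<in> borel_measurable borel" "\<psi> \<in> borel_measurable borel"
  by (auto intro: borel_measurable_continuous_onI continuous_generator continuous_d continuous_\<psi>)

lemma bregman_nonneg: "0 \<le> bregman \<phi> x y"
  using tangent_le[of y x] by (simp add: bregman_def)

lemma bregman_self [simp]: "bregman \<phi> x x = 0"
  by (simp add: bregman_def)

text \<open>The tangent inequality at the new point \<open>x\<close>. It bounds the change of the
  divergence by a first-order term, so that no differentiation under the integral sign is needed
  later.\<close>

lemma bregman_diff_le: "bregman \<phi> x z - bregman \<phi> y z \<le> (d x - d z) * (x - y)"
  using tangent_le[of x y] by (simp add: bregman_def algebra_simps)

text \<open>This and \<open>bregman_mono_left\<close> serve to compare candidates with different
  multipliers, which lie on the same side of the reference quantile.\<close>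

lemma bregman_mono_right:
  assumes "z \<le> x" "x < y"
  shows "bregman \<phi> x z < bregman \<phi> y z"
proof -
  have "bregman \<phi> y z - bregman \<phi> x z > d x * (y - x) - d z * (y - x)"
    using tangent_less[of x y] assms by (simp add: bregman_def algebra_simps)
  moreover have "d z * (y - x) \<le> d x * (y - x)"
    using assms by (intro mult_right_mono) auto
  ultimately show ?thesis by simp
qed

lemma bregman_mono_left:
  assumes "x \<le> z" "y < x"
  shows "bregman \<phi> x z < bregman \<phi> y z"
proof -
  have "bregman \<phi> y z - bregman \<phi> x z > (d z - d x) * (x - y)"
    using tangent_less[of x y] assms by (simp add: bregman_def algebra_simps)
  moreover have "0 \<le> (d z - d x) * (x - y)"
    using assms by (intro mult_nonneg_nonneg) auto
  ultimately show ?thesis by simp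
qed

lemma bregman_convex:
  assumes "0 \<le> t" "t \<le> 1"
  shows "bregman \<phi> ((1 - t) * x + t * y) z \<le> (1 - t) * bregman \<phi> x z + t * bregman \<phi> y z"
proof -
  have "\<phi> ((1 - t) * x + t * y) \<le> (1 - t) * \<phi> x + t * \<phi> y"
    using convex_onD[OF strictly_convex_imp_convex_on, of \<phi> t x y] strict_generator assms
    unfolding strict_bregman_generator_def by simp
  then show ?thesis by (simp add: bregman_def algebra_simps)
qed

lemma bregman_midpoint_less:
  assumes "x \<noteq> y"
  shows "bregman \<phi> ((1 - 1/2) * x + (1/2) * y) z < (1 - 1/2) * bregman \<phi> x z + (1/2) * bregman \<phi> y z"
proof -
  have "\<phi> ((1 - 1/2) * x + (1/2) * y) < (1 - 1/2) * \<phi> x + (1/2) * \<phi> y"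
    by (rule strict_convexity[OF assms]) simp_all
  then show ?thesis by (simp add: bregman_def algebra_simps)
qed

end

section \<open>Quantile functions on the unit interval\<close>

lemma space_unif [simp]: "space unif = {0<..<1}"
  by (simp add: space_restrict_space)

interpretation unif: prob_space unif
proof
  show "emeasure unif (space unif) = 1"
    by (simp add: emeasure_restrict_space)
qed

text \<open>Monotone functions are Borel, and \<open>unif\<close> has at least the Borel sets as
  measurable sets.\<close>

lemma mono_on_unif_measurable:
  fixes g :: "real \<Rightarrow> real"
  assumes "mono_on {0<..<1} g"
  shows "g \<in> borel_measurable unif"
proof -
  have "g \<in> borel_measurable (restrict_space borel {0<..<1})"
    by (rule borel_measurable_mono_on_fnc[OF assms])
  then show ?thesis
    by (rule borel_measurable_subalgebra[rotated 2])
      (simp_all only: sets_restrict_space space_restrict_space space_borel space_completion space_lborel,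
        intro image_mono subsetI, simp)
qed

lemma measure_unif:
  assumes "A \<in> sets borel" "A \<subseteq> {0<..<1}"
  shows "measure unif A = measure lborel A"
  using assms by (subst measure_restrict_space) (simp_all add: measure_completion)

lemma prob_unif_le:
  assumes "0 \<le> t" "t \<le> 1"
  shows "measure unif {u \<in> {0<..<1}. u \<le> t} = t"
proof -
  have "{u \<in> {0<..<1}. u \<le> t} = (if t = 1 then {0<..<1} else {0<..t})"
    using assms by auto
  then show ?thesis
    using assms by (cases "t = 1") (simp_all add: measure_unif subset_eq)
qed

text \<open>The Galois connection between a cdf and its quantile function. Monotonicity, left
  continuity and the law of the quantile function are all read off from it.\<close>

lemma quantile_le_iff:
  assumes "is_cdf F" "0 < u" "u < 1"
  shows "quantile F u \<le> x \<longleftrightarrow> u \<le> F x"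
proof -
  obtain M where M: "real_distribution M" "F = cdf M"
    using assms(1) unfolding is_cdf_def by blast
  then interpret cdf_distribution M unfolding cdf_distribution_def by simp
  show ?thesis unfolding quantile_def M(2) by (rule pseudoinverse[OF assms(2,3), symmetric])
qed

lemma quantile_mono:
  assumes "is_cdf F"
  shows "mono_on {0<..<1} (quantile F)"
proof (rule mono_onI)
  fix u v :: real
  assume "u \<in> {0<..<1}" "v \<in> {0<..<1}" "u \<le> v"
  then show "quantile F u \<le> quantile F v"
    using quantile_le_iff[OF assms, of u] quantile_le_iff[OF assms, of v "quantile F v"] by auto
qed

text \<open>Monotonicity already bounds the values on the left by \<open>g u\<close>; what remains
  is to approach \<open>g u\<close> from below, and one point \<open>v\<close> per level suffices
  because \<open>g\<close> stays above \<open>g v\<close> afterwards.\<close>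

lemma continuous_at_leftI_mono:
  fixes g :: "real \<Rightarrow> real"
  assumes g: "mono_on {0<..<1} g" and u: "u \<in> {0<..<1}"
    and ex: "\<And>x. x < g u \<Longrightarrow> \<exists>v\<in>{0<..<u}. x < g v"
  shows "continuous (at_left u) g"
  unfolding continuous_within
proof (rule increasing_tendsto)
  show "\<forall>\<^sub>F v in at_left u. g v \<le> g u"
    using eventually_at_left_real[of 0 u] u by (auto elim!: eventually_mono intro!: mono_onD[OF g])
next
  fix x assume "x < g u"
  then obtain v where v: "v \<in> {0<..<u}" "x < g v" using ex by blast
  have "g v \<le> g w" if "w \<in> {v<..<u}" for w
    using that v u by (intro mono_onD[OF g]) auto
  then show "\<forall>\<^sub>F w in at_left u. x < g w"
    using eventually_at_left_real[of v u] v by (force elim!: eventually_mono)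
qed

lemma quantile_continuous_at_left:
  assumes "is_cdf F" "u \<in> {0<..<1}"
  shows "continuous (at_left u) (quantile F)"
proof (rule continuous_at_leftI_mono[OF quantile_mono[OF assms(1)] assms(2)])
  fix x assume "x < quantile F u"
  then have "F x < u" using quantile_le_iff[of F u x] assms by force
  then obtain v where v: "max 0 (F x) < v" "v < u" using dense[of "max 0 (F x)" u] assms by auto
  then show "\<exists>v\<in>{0<..<u}. x < quantile F v"
    using quantile_le_iff[of F v x] assms by (intro bexI[of _ v]) (auto simp: not_le[symmetric])
qed

text \<open>No left neighbourhood is a null set, so points of agreement accumulate at
  \<open>u\<close> from the left, and a limit of a frequently vanishing difference is zero. This
  upgrades almost-everywhere identities of quantile functions to pointwise ones.\<close>

lemma continuous_at_left_eqI:
  fixes g k :: "real \<Rightarrow> real"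
  assumes "continuous (at_left u) g" "continuous (at_left u) k" "u \<in> {0<..<1}"
    and "AE v in unif. g v = k v"
  shows "g u = k u"
proof -
  obtain N where N: "N \<in> null_sets lebesgue" "{v \<in> {0<..<1}. g v \<noteq> k v} \<subseteq> N"
    using assms(4) by (subst (asm) AE_restrict_space_iff) (auto simp: eventually_ae_filter)
  have "\<exists>v\<in>{x<..<u}. g v = k v" if "x < u" for x
  proof (rule ccontr)
    assume "\<not> ?thesis"
    then have "{max x 0<..<u} \<subseteq> N" using N(2) assms(3) by force
    then have "{max x 0<..<u} \<in> null_sets lebesgue"
      using N(1) null_sets_completion_subset by blast
    then show False using that assms(3) by (auto simp: null_sets_def)
  qed
  then have fr: "\<exists>\<^sub>F v in at_left u. g v - k v = 0"
    unfolding frequently_def eventually_at_left_field by fastforce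
  have "((\<lambda>v. g v - k v) \<longlongrightarrow> g u - k u) (at_left u)"
    using assms(1,2) unfolding continuous_within by (intro tendsto_intros)
  then have "g u - k u \<noteq> 0 \<Longrightarrow> \<forall>\<^sub>F v in at_left u. g v - k v \<noteq> 0"
    by (rule tendsto_imp_eventually_ne)
  then show ?thesis
    using fr by (auto simp: frequently_def)
qed

lemma distr_unif_mono:
  fixes g :: "real \<Rightarrow> real"
  assumes g: "mono_on {0<..<1} g"
  shows "real_distribution (distr unif borel g)"
    "\<And>x. cdf (distr unif borel g) x = measure unif {u \<in> {0<..<1}. g u \<le> x}"
proof -
  have [measurable]: "g \<in> borel_measurable unif" by (rule mono_on_unif_measurable[OF g])
  show "real_distribution (distr unif borel g)"
    using unif.prob_space_distr[of g borel] by (simp add: real_distribution_def real_distribution_axioms_def)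
  show "cdf (distr unif borel g) x = measure unif {u \<in> {0<..<1}. g u \<le> x}" for x
    by (simp add: cdf_def measure_distr vimage_def Int_def conj_commute)
qed

text \<open>Let \<open>G\<close> be the cdf of the law of \<open>g\<close>. Monotonicity gives
  \<open>u \<le> G (g u)\<close>. For \<open>x < g u\<close>, left continuity gives some
  \<open>v < u\<close> with \<open>x < g v\<close>, hence \<open>G x \<le> v < u\<close>. The Galois
  connection leaves only the value \<open>g u\<close>.\<close>

lemma quantile_distr_unif:
  fixes g :: "real \<Rightarrow> real"
  assumes g: "mono_on {0<..<1} g" and u: "u \<in> {0<..<1}" and cont: "continuous (at_left u) g"
  shows "quantile (cdf (distr unif borel g)) u = g u"
proof -
  have [measurable]: "g \<in> borel_measurable unif" by (rule mono_on_unif_measurable[OF g])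
  let ?G = "cdf (distr unif borel g)"
  have G: "is_cdf ?G" using distr_unif_mono(1)[OF g] unfolding is_cdf_def by blast
  have 1: "u \<le> ?G (g u)"
  proof -
    have "{v \<in> {0<..<1}. v \<le> u} \<subseteq> {v \<in> space unif. g v \<le> g u}"
      using u by (auto intro!: mono_onD[OF g])
    then have "measure unif {v \<in> {0<..<1}. v \<le> u} \<le> measure unif {v \<in> space unif. g v \<le> g u}"
      by (rule unif.finite_measure_mono) measurable
    then show ?thesis using u by (simp add: prob_unif_le[simplified] distr_unif_mono(2)[OF g])
  qed
  have 2: "?G x < u" if x: "x < g u" for x
  proof -
    have "\<forall>\<^sub>F v in at_left u. x < g v"
      using cont x unfolding continuous_within by (rule order_tendstoD(1))
    then have "\<forall>\<^sub>F v in at_left u. x < g v \<and> v \<in> {0<..<u}"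
      using u by (intro eventually_conj eventually_at_left_real) auto
    then obtain v where v: "x < g v" "0 < v" "v < u"
      using eventually_happens[of _ "at_left u"] by force
    have "{w \<in> space unif. g w \<le> x} \<subseteq> {w \<in> {0<..<1}. w \<le> v}"
    proof safe
      fix w assume w: "w \<in> space unif" "g w \<le> x"
      then show "w \<le> v" using mono_onD[OF g, of v w] v u by force
    qed auto
    then have "measure unif {w \<in> space unif. g w \<le> x} \<le> measure unif {w \<in> {0<..<1}. w \<le> v}"
      by (rule unif.finite_measure_mono) (use v u in \<open>auto simp: sets_restrict_space_iff\<close>)
    then show ?thesis using v u by (simp add: prob_unif_le[simplified] distr_unif_mono(2)[OF g])
  qed
  show ?thesis
    using 1 2 quantile_le_iff[OF G, of u] u by (metis greaterThanLessThan_iff linorder_neqE_linordered_idom order_refl not_le)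
qed

lemma AE_continuous_at_left:
  fixes g :: "real \<Rightarrow> real"
  assumes g: "mono_on {0<..<1} g"
  shows "AE u in unif. continuous (at_left u) g"
proof -
  have "countable {a \<in> {0<..<1}. \<not> isCont g a}"
    using mono_on_ctble_discont_open[of "{0<..<1}" g] g by simp
  then have N: "{a \<in> {0<..<1}. \<not> isCont g a} \<in> null_sets lebesgue"
    using countable_imp_null_set_lborel null_sets_completionI by blast
  have "AE u in lebesgue. u \<in> {0<..<1} \<longrightarrow> continuous (at_left u) g"
    by (rule AE_I'[OF N]) (auto intro: continuous_at_imp_continuous_within)
  then show ?thesis by (subst AE_restrict_space_iff) auto
qed

text \<open>A monotone function has countably many discontinuities, so the quantile function of its
  law is a left-continuous version of it. This allows the optimisation to run over all monotone
  functions.\<close>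

lemma quantile_distr_unif_AE:
  fixes g :: "real \<Rightarrow> real"
  assumes g: "mono_on {0<..<1} g"
  shows "AE u in unif. quantile (cdf (distr unif borel g)) u = g u"
  using AE_continuous_at_left[OF g] AE_space[of unif]
  by eventually_elim (use quantile_distr_unif[OF g] in auto)

lemma moment_cdfs_distr_unif:
  fixes g :: "real \<Rightarrow> real"
  assumes g: "mono_on {0<..<1} g" and "integrable unif (\<lambda>u. \<bar>g u\<bar> powr p)"
  shows "cdf (distr unif borel g) \<in> moment_cdfs p"
proof -
  have [measurable]: "g \<in> borel_measurable unif" by (rule mono_on_unif_measurable[OF g])
  have "integrable (distr unif borel g) (\<lambda>x. \<bar>x\<bar> powr p)"
    using assms by (subst integrable_distr_eq) auto
  then show ?thesis
    using distr_unif_mono(1)[OF g] unfolding moment_cdfs_def by blast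
qed

lemma moment_cdfs_is_cdf: "G \<in> moment_cdfs p \<Longrightarrow> is_cdf G"
  unfolding moment_cdfs_def is_cdf_def by blast

text \<open>Inverse transform sampling. It translates the moment condition on a law into
  integrability of its quantile function.\<close>

lemma distr_quantile:
  assumes M: "real_distribution M"
  shows "distr unif borel (quantile (cdf M)) = M"
proof (rule cdf_unique[OF _ M])
  have F: "is_cdf (cdf M)" using M unfolding is_cdf_def by blast
  note mono = quantile_mono[OF F]
  show "real_distribution (distr unif borel (quantile (cdf M)))" by (rule distr_unif_mono(1)[OF mono])
  interpret real_distribution M by (rule M)
  show "cdf (distr unif borel (quantile (cdf M))) = cdf M"
  proof
    fix x
    have "{u \<in> {0<..<1}. quantile (cdf M) u \<le> x} = {u \<in> {0<..<1}. u \<le> cdf M x}"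
      using quantile_le_iff[OF F] by auto
    then show "cdf (distr unif borel (quantile (cdf M))) x = cdf M x"
      using cdf_nonneg cdf_bounded_prob by (simp add: distr_unif_mono(2)[OF mono] prob_unif_le[simplified])
  qed
qed

lemma integrable_quantile_moment:
  assumes "G \<in> moment_cdfs p"
  shows "integrable unif (\<lambda>u. \<bar>quantile G u\<bar> powr p)"
proof -
  obtain M where M: "real_distribution M" "integrable M (\<lambda>x. \<bar>x\<bar> powr p)" "G = cdf M"
    using assms unfolding moment_cdfs_def by blast
  have [measurable]: "quantile G \<in> borel_measurable unif"
    by (rule mono_on_unif_measurable[OF quantile_mono[OF moment_cdfs_is_cdf[OF assms]]])
  have "integrable (distr unif borel (quantile G)) (\<lambda>x. \<bar>x\<bar> powr p)"
    using M distr_quantile[of M] by simp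
  then show ?thesis by (subst (asm) integrable_distr_eq) auto
qed

section \<open>Isotonic projection\<close>

lemma square_integrable_imp_integrable:
  fixes l :: "real \<Rightarrow> real"
  assumes [measurable]: "l \<in> borel_measurable unif" and "integrable unif (\<lambda>u. (l u)\<^sup>2)"
  shows "integrable unif l"
proof (rule Bochner_Integration.integrable_bound)
  show "integrable unif (\<lambda>u. (l u)\<^sup>2 + 1)" using assms(2) by auto
  have "\<bar>x\<bar> \<le> x\<^sup>2 + 1" for x :: real
    using zero_le_power2[of "\<bar>x\<bar> - 1"] by (simp add: power2_diff)
  then show "AE u in unif. norm (l u) \<le> norm ((l u)\<^sup>2 + 1)"
    by (intro AE_I2) (auto simp: abs_of_nonneg add_nonneg_nonneg)
qed measurable

lemma integrable_square_diff:
  fixes k l :: "real \<Rightarrow> real"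
  assumes [measurable]: "k \<in> borel_measurable unif" "l \<in> borel_measurable unif"
    and "integrable unif (\<lambda>u. (k u)\<^sup>2)" "integrable unif (\<lambda>u. (l u)\<^sup>2)"
  shows "integrable unif (\<lambda>u. (k u - l u)\<^sup>2)"
proof (rule Bochner_Integration.integrable_bound)
  show "integrable unif (\<lambda>u. 2 * (k u)\<^sup>2 + 2 * (l u)\<^sup>2)" using assms(3,4) by auto
  have "(x - y)\<^sup>2 \<le> 2 * x\<^sup>2 + 2 * y\<^sup>2" for x y :: real
    using zero_le_power2[of "x + y"] by (simp add: power2_eq_square algebra_simps)
  then show "AE u in unif. norm ((k u - l u)\<^sup>2) \<le> norm (2 * (k u)\<^sup>2 + 2 * (l u)\<^sup>2)"
    by (intro AE_I2) (simp add: abs_of_nonneg)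
qed measurable

lemma integrable_square_add:
  fixes k l :: "real \<Rightarrow> real"
  assumes [measurable]: "k \<in> borel_measurable unif" "l \<in> borel_measurable unif"
    and "integrable unif (\<lambda>u. (k u)\<^sup>2)" "integrable unif (\<lambda>u. (l u)\<^sup>2)"
  shows "integrable unif (\<lambda>u. (k u + l u)\<^sup>2)"
  using integrable_square_diff[of k "\<lambda>u. - l u"] assms by simp

lemma integrable_mult_bounded:
  fixes l w :: "real \<Rightarrow> real"
  assumes "integrable unif l" and [measurable]: "w \<in> borel_measurable unif"
    and "\<And>u. u \<in> {0<..<1} \<Longrightarrow> \<bar>w u\<bar> \<le> 1"
  shows "integrable unif (\<lambda>u. l u * w u)"
proof (rule Bochner_Integration.integrable_bound[OF assms(1)])
  show "(\<lambda>u. l u * w u) \<in> borel_measurable unif"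
    using borel_measurable_integrable[OF assms(1)] by measurable
  show "AE u in unif. norm (l u * w u) \<le> norm (l u)"
    using assms(3) by (intro AE_I2) (auto simp: abs_mult mult_left_le)
qed

text \<open>An interval of positive length is not a null set. The lemma supplies points close to a
  given one at which an almost-everywhere identity may be evaluated.\<close>

lemma AE_unif_interval:
  assumes "AE u in unif. P u" "0 \<le> x" "x < y" "y \<le> 1"
  obtains u where "x < u" "u < y" "P u"
proof -
  have "AE u in lebesgue. u \<in> {0<..<1} \<longrightarrow> P u"
    using assms(1) by (subst (asm) AE_restrict_space_iff) auto
  then obtain N where N: "N \<in> null_sets lebesgue" "{u. \<not> (u \<in> {0<..<1} \<longrightarrow> P u)} \<subseteq> N"
    by (auto simp: eventually_ae_filter)
  have "\<exists>u\<in>{x<..<y}. P u"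
  proof (rule ccontr)
    assume "\<not> ?thesis"
    then have "{x<..<y} \<subseteq> N" using N(2) assms(2-4) by fastforce
    then have "{x<..<y} \<in> null_sets lebesgue"
      using N(1) null_sets_completion_subset by blast
    then show False using assms(3) by (auto simp: null_sets_def)
  qed
  then show ?thesis using that by auto
qed

lemma integral_nonpos_imp_AE_0:
  fixes e :: "real \<Rightarrow> real"
  assumes "integrable unif e" "\<And>u. u \<in> {0<..<1} \<Longrightarrow> 0 \<le> e u" "(\<integral>u. e u \<partial>unif) \<le> 0"
  shows "AE u in unif. e u = 0"
proof -
  have nn: "AE u in unif. 0 \<le> e u" using assms(2) by (intro AE_I2) simp
  then have "(\<integral>u. e u \<partial>unif) = 0" using assms(3) integral_nonneg_AE[OF nn] by simp
  then show ?thesis using integral_nonneg_eq_0_iff_AE[OF assms(1) nn] by simp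
qed

definition square_dist :: "(real \<Rightarrow> real) \<Rightarrow> (real \<Rightarrow> real) \<Rightarrow> real" where
  "square_dist l j = (\<integral>u. (j u - l u)\<^sup>2 \<partial>unif)"

text \<open>A predicate rather than a function: order, mean and level-set properties can then be
  proved for any minimiser, and existence is needed only to connect with
  \<open>isotonic_proj\<close>, which is a choice among minimisers.\<close>

definition isotonic_min :: "(real \<Rightarrow> real) \<Rightarrow> (real \<Rightarrow> real) \<Rightarrow> bool" where
  "isotonic_min l k \<longleftrightarrow> k \<in> isotonic_cone \<and> (\<forall>j\<in>isotonic_cone. square_dist l k \<le> square_dist l j)"

definition square_integrable :: "(real \<Rightarrow> real) \<Rightarrow> bool" where
  "square_integrable l \<longleftrightarrow> l \<in> borel_measurable unif \<and> integrable unif (\<lambda>u. (l u)\<^sup>2)"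

lemma isotonic_cone_square_integrable: "j \<in> isotonic_cone \<Longrightarrow> square_integrable j"
  unfolding isotonic_cone_def square_integrable_def by (auto intro: mono_on_unif_measurable)

lemma square_integrable_diff:
  "square_integrable k \<Longrightarrow> square_integrable l \<Longrightarrow> square_integrable (\<lambda>u. k u - l u)"
  unfolding square_integrable_def by (auto intro: integrable_square_diff)

lemma square_integrable_add:
  "square_integrable k \<Longrightarrow> square_integrable l \<Longrightarrow> square_integrable (\<lambda>u. k u + l u)"
  unfolding square_integrable_def by (auto intro: integrable_square_add)

lemma square_integrable_cmult: "square_integrable k \<Longrightarrow> square_integrable (\<lambda>u. c * k u)"
  unfolding square_integrable_def by (auto simp: power_mult_distrib)

lemma square_integrable_const: "square_integrable (\<lambda>u. c)"
  unfolding square_integrable_def by auto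

lemma square_integrable_max:
  assumes "square_integrable k" "square_integrable l"
  shows "square_integrable (\<lambda>u. max (k u) (l u))"
proof -
  have [measurable]: "k \<in> borel_measurable unif" "l \<in> borel_measurable unif"
    using assms unfolding square_integrable_def by auto
  have "integrable unif (\<lambda>u. (max (k u) (l u))\<^sup>2)"
  proof (rule Bochner_Integration.integrable_bound)
    show "integrable unif (\<lambda>u. (k u)\<^sup>2 + (l u)\<^sup>2)"
      using assms unfolding square_integrable_def by auto
    show "AE u in unif. norm ((max (k u) (l u))\<^sup>2) \<le> norm ((k u)\<^sup>2 + (l u)\<^sup>2)"
      by (intro AE_I2) (auto simp: max_def)
  qed measurable
  then show ?thesis unfolding square_integrable_def by auto
qed

lemma square_integrable_min:
  assumes "square_integrable k" "square_integrable l"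
  shows "square_integrable (\<lambda>u. min (k u) (l u))"
proof -
  have "min x y = - 1 * max (- 1 * x) (- 1 * y)" for x y :: real by (simp add: min_def max_def)
  then show ?thesis
    by (simp only:) (intro square_integrable_cmult square_integrable_max assms)
qed

lemma square_integrable_power2: "square_integrable k \<Longrightarrow> integrable unif (\<lambda>u. (k u)\<^sup>2)"
  unfolding square_integrable_def by auto

lemma square_integrable_integrable: "square_integrable k \<Longrightarrow> integrable unif k"
  unfolding square_integrable_def by (auto intro: square_integrable_imp_integrable)

lemma square_integrable_mult:
  assumes "square_integrable k" "square_integrable l"
  shows "integrable unif (\<lambda>u. k u * l u)"
proof -
  have "(\<lambda>u. k u * l u) = (\<lambda>u. (1/4) * ((k u + l u)\<^sup>2 - (k u - l u)\<^sup>2))"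
    by (simp add: power2_eq_square algebra_simps)
  then show ?thesis
    using square_integrable_power2[OF square_integrable_add[OF assms]]
      square_integrable_power2[OF square_integrable_diff[OF assms]] by simp
qed

section \<open>The cone of isotonic functions\<close>

lemma isotonic_coneI:
  assumes "mono_on {0<..<1} j" "\<And>u. u \<in> {0<..<1} \<Longrightarrow> continuous (at_left u) j" "square_integrable j"
  shows "j \<in> isotonic_cone"
  using assms unfolding isotonic_cone_def square_integrable_def by auto

lemma isotonic_coneD:
  assumes "j \<in> isotonic_cone"
  shows "mono_on {0<..<1} j" "\<And>u. u \<in> {0<..<1} \<Longrightarrow> continuous (at_left u) j" "square_integrable j"
  using assms isotonic_cone_square_integrable unfolding isotonic_cone_def by auto

lemma isotonic_cone_max:
  assumes "j \<in> isotonic_cone" "k \<in> isotonic_cone"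
  shows "(\<lambda>u. max (j u) (k u)) \<in> isotonic_cone"
  using isotonic_coneD[OF assms(1)] isotonic_coneD[OF assms(2)]
  by (intro isotonic_coneI square_integrable_max continuous_max)
    (auto simp: mono_on_def max.coboundedI1 max.coboundedI2)

lemma isotonic_cone_min:
  assumes "j \<in> isotonic_cone" "k \<in> isotonic_cone"
  shows "(\<lambda>u. min (j u) (k u)) \<in> isotonic_cone"
  using isotonic_coneD[OF assms(1)] isotonic_coneD[OF assms(2)]
  by (intro isotonic_coneI square_integrable_min continuous_min)
    (auto simp: mono_on_def min.coboundedI1 min.coboundedI2)

lemma isotonic_cone_add:
  assumes "j \<in> isotonic_cone" "k \<in> isotonic_cone"
  shows "(\<lambda>u. j u + k u) \<in> isotonic_cone"
  using isotonic_coneD[OF assms(1)] isotonic_coneD[OF assms(2)]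
  by (intro isotonic_coneI square_integrable_add continuous_add)
    (auto simp: mono_on_def intro: add_mono)

lemma isotonic_cone_scale:
  assumes "j \<in> isotonic_cone" "0 \<le> c"
  shows "(\<lambda>u. c * j u) \<in> isotonic_cone"
  using isotonic_coneD[OF assms(1)] assms(2)
  by (intro isotonic_coneI square_integrable_cmult continuous_intros)
    (auto simp: mono_on_def intro: mult_left_mono)

lemma isotonic_cone_const: "(\<lambda>u. c) \<in> isotonic_cone"
  by (intro isotonic_coneI square_integrable_const) (auto simp: mono_on_def)

lemma isotonic_cone_midpoint:
  assumes "j \<in> isotonic_cone" "k \<in> isotonic_cone"
  shows "(\<lambda>u. 1/2 * (j u + k u)) \<in> isotonic_cone"
  by (intro isotonic_cone_scale isotonic_cone_add assms) simp

section \<open>Uniqueness, order and mean of the projection\<close>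

text \<open>Since midpoints stay in the cone, the last term is at least four times the minimal
  distance. This gives uniqueness of the minimiser and makes consecutive terms of a minimising
  sequence close to each other.\<close>

lemma parallelogram:
  assumes "square_integrable l" "square_integrable j" "square_integrable k"
  shows "square_dist k j = 2 * square_dist l j + 2 * square_dist l k - 4 * square_dist l (\<lambda>u. 1/2 * (j u + k u))"
proof -
  have "(j u - k u)\<^sup>2 = 2 * (j u - l u)\<^sup>2 + 2 * (k u - l u)\<^sup>2 - 4 * (1/2 * (j u + k u) - l u)\<^sup>2" for u
    by (simp add: power2_eq_square field_simps)
  then show ?thesis
    unfolding square_dist_def
    using square_integrable_power2[OF square_integrable_diff[OF assms(2,1)]]
      square_integrable_power2[OF square_integrable_diff[OF assms(3,1)]]
      square_integrable_power2[OF square_integrable_diff[OF square_integrable_cmult[OF square_integrable_add[OF assms(2,3)]] assms(1)], of "1/2"]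
    by simp
qed

lemma isotonic_min_unique:
  assumes l: "square_integrable l" and k: "isotonic_min l k" and k': "isotonic_min l k'"
  shows "AE u in unif. k u = k' u"
proof -
  have c: "k \<in> isotonic_cone" "k' \<in> isotonic_cone" using k k' unfolding isotonic_min_def by auto
  note s = isotonic_cone_square_integrable[OF c(1)] isotonic_cone_square_integrable[OF c(2)]
  have "square_dist l k \<le> square_dist l (\<lambda>u. 1/2 * (k u + k' u))"
      "square_dist l k' \<le> square_dist l (\<lambda>u. 1/2 * (k u + k' u))"
    using k k' isotonic_cone_midpoint[OF c] unfolding isotonic_min_def by auto
  then have "(\<integral>u. (k u - k' u)\<^sup>2 \<partial>unif) \<le> 0"
    using parallelogram[OF l s] unfolding square_dist_def by simp
  then have "AE u in unif. (k u - k' u)\<^sup>2 = 0"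
    using square_integrable_power2[OF square_integrable_diff[OF s]]
    by (intro integral_nonpos_imp_AE_0) auto
  then show ?thesis by (auto elim: eventually_mono)
qed

text \<open>Replacing the two minimisers by their pointwise minimum and maximum does not increase the
  sum of the two distances.\<close>

lemma isotonic_min_mono:
  assumes l: "square_integrable l" "square_integrable l'" and le: "AE u in unif. l u \<le> l' u"
    and k: "isotonic_min l k" and k': "isotonic_min l' k'"
  shows "AE u in unif. k u \<le> k' u"
proof -
  have c: "k \<in> isotonic_cone" "k' \<in> isotonic_cone" using k k' unfolding isotonic_min_def by auto
  let ?a = "\<lambda>u. min (k u) (k' u)" and ?b = "\<lambda>u. max (k u) (k' u)"
  have ab: "?a \<in> isotonic_cone" "?b \<in> isotonic_cone"
    by (intro isotonic_cone_min isotonic_cone_max c)+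
  have I: "integrable unif (\<lambda>u. (j u - m u)\<^sup>2)" if "j \<in> isotonic_cone" "square_integrable m" for j m
    by (rule square_integrable_power2[OF square_integrable_diff[OF isotonic_cone_square_integrable[OF that(1)] that(2)]])
  \<comment> \<open>Where the minimisers are in the wrong order, swapping them lowers the sum of
    squares by \<open>2 * (k u - k' u) * (l' u - l u)\<close>.\<close>
  have pt: "(?a u - l u)\<^sup>2 + (?b u - l' u)\<^sup>2 \<le> (k u - l u)\<^sup>2 + (k' u - l' u)\<^sup>2" if "l u \<le> l' u" for u
  proof (cases "k u \<le> k' u")
    case False
    then have "0 \<le> (k u - k' u) * (l' u - l u)" using that by simp
    then show ?thesis using False by (simp add: min_def max_def power2_eq_square algebra_simps)
  qed (simp add: min_def max_def)
  have "(\<integral>u. (?a u - l u)\<^sup>2 + (?b u - l' u)\<^sup>2 \<partial>unif) \<le> (\<integral>u. (k u - l u)\<^sup>2 + (k' u - l' u)\<^sup>2 \<partial>unif)"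
    using le by (intro integral_mono_AE Bochner_Integration.integrable_add I c ab l)
      (auto elim!: eventually_mono intro: pt)
  then have "square_dist l ?a + square_dist l' ?b \<le> square_dist l k + square_dist l' k'"
    unfolding square_dist_def using I c ab l by simp
  moreover have "square_dist l' k' \<le> square_dist l' ?b"
    using k' ab(2) unfolding isotonic_min_def by blast
  \<comment> \<open>\<open>?b\<close> is no closer to \<open>l'\<close> than \<open>k'\<close> is,
    so \<open>?a\<close> must be at least as close to \<open>l\<close> as \<open>k\<close>.\<close>
  ultimately have "isotonic_min l ?a"
    using k ab(1) unfolding isotonic_min_def by (auto intro: order_trans)
  then have "AE u in unif. ?a u = k u" using isotonic_min_unique[OF l(1) _ k] by simp
  then show ?thesis by (auto elim!: eventually_mono)
qed

text \<open>The square is expanded around \<open>k\<close> with its quadratic term kept. Only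
  \<open>k + v\<close> has to lie in the cone, so \<open>v\<close> may be a truncation for which no
  linear path is at hand.\<close>

lemma isotonic_min_variation:
  assumes l: "square_integrable l" and k: "isotonic_min l k"
    and v: "square_integrable v" and kv: "(\<lambda>u. k u + v u) \<in> isotonic_cone"
  shows "0 \<le> (\<integral>u. (v u)\<^sup>2 + 2 * (v u * (k u - l u)) \<partial>unif)"
proof -
  have s: "square_integrable k" using k unfolding isotonic_min_def by (auto intro: isotonic_cone_square_integrable)
  have eq: "(k u + v u - l u)\<^sup>2 = (k u - l u)\<^sup>2 + ((v u)\<^sup>2 + 2 * (v u * (k u - l u)))" for u
    by (simp add: power2_eq_square algebra_simps)
  have I: "integrable unif (\<lambda>u. (v u)\<^sup>2 + 2 * (v u * (k u - l u)))"
    using square_integrable_power2[OF v] square_integrable_mult[OF v square_integrable_diff[OF s l]] by auto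
  have "square_dist l k \<le> square_dist l (\<lambda>u. k u + v u)"
    using k kv unfolding isotonic_min_def by blast
  then show ?thesis
    unfolding square_dist_def eq
    using Bochner_Integration.integral_add[OF square_integrable_power2[OF square_integrable_diff[OF s l]] I] by simp
qed

text \<open>The cone is invariant under adding constants of either sign, so the quadratic
  \<open>t^2 + 2 * t * r\<close> is non-negative for all \<open>t\<close>, which forces
  \<open>r = 0\<close>.\<close>

lemma isotonic_min_mean:
  assumes l: "square_integrable l" and k: "isotonic_min l k"
  shows "(\<integral>u. k u \<partial>unif) = (\<integral>u. l u \<partial>unif)"
proof -
  have c: "k \<in> isotonic_cone" using k unfolding isotonic_min_def by auto
  have Ik: "integrable unif k" and Il: "integrable unif l"
    using isotonic_cone_square_integrable[OF c] l by (auto intro: square_integrable_integrable)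
  define r where "r = (\<integral>u. k u \<partial>unif) - (\<integral>u. l u \<partial>unif)"
  have prob: "measure unif {0<..<1} = 1" using unif.prob_space by simp
  have "0 \<le> t\<^sup>2 + 2 * (t * r)" for t
  proof -
    have "0 \<le> (\<integral>u. t\<^sup>2 + 2 * (t * (k u - l u)) \<partial>unif)"
      using isotonic_min_variation[OF l k square_integrable_const[of t] isotonic_cone_add[OF c isotonic_cone_const]] .
    also have "\<dots> = t\<^sup>2 + 2 * (t * r)"
      using Ik Il prob by (simp add: r_def)
    finally show ?thesis .
  qed
  \<comment> \<open>\<open>- r\<close> minimises the quadratic, with value
    \<open>- r^2\<close>.\<close>
  from this[of "- r"] have "r\<^sup>2 \<le> 0" by (simp add: power2_eq_square)
  then have "r = 0" by simp
  then show ?thesis by (simp add: r_def)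
qed

section \<open>Variational inequalities on the level sets of the projection\<close>

lemma measurable_of_bool_less [measurable]:
  fixes k :: "real \<Rightarrow> real"
  assumes [measurable]: "k \<in> borel_measurable unif"
  shows "(\<lambda>u. of_bool (m < k u) :: real) \<in> borel_measurable unif"
    and "(\<lambda>u. of_bool (k u < m) :: real) \<in> borel_measurable unif"
  unfolding of_bool_def by measurable

text \<open>The passage from small truncated perturbations, rescaled to unit size, to a weight on
  the level set where \<open>x\<close> is positive.\<close>

lemma truncated_scaling_tendsto:
  fixes D x :: real
  assumes "0 \<le> D"
  shows "(\<lambda>n. max 0 (min D (real (Suc n) * x))) \<longlonglongrightarrow> of_bool (0 < x) * D"
proof (cases "0 < x")
  case True
  have "filterlim (\<lambda>n. x * real (Suc n)) at_top sequentially"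
    using True by (intro filterlim_tendsto_pos_mult_at_top[OF tendsto_const]
        filterlim_compose[OF filterlim_real_sequentially filterlim_Suc]) auto
  then have "\<forall>\<^sub>F n in sequentially. D \<le> x * real (Suc n)"
    by (simp add: filterlim_at_top)
  then have "\<forall>\<^sub>F n in sequentially. max 0 (min D (real (Suc n) * x)) = of_bool (0 < x) * D"
    using assms True by (auto elim!: eventually_mono simp: mult.commute)
  then show ?thesis by (rule tendsto_eventually)
next
  case False
  then have "max 0 (min D (real (Suc n) * x)) = 0" for n
    using mult_nonneg_nonpos[of "real (Suc n)" x] by (auto simp: min_def max_def simp del: of_nat_Suc)
  then show ?thesis using False by simp
qed

text \<open>Lower \<open>k\<close> by \<open>s * D\<close>, but never below \<open>m\<close>. As
  \<open>- D\<close> is increasing, the result stays in the cone, and only the part above level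
  \<open>m\<close> moves. Minimality bounds the first-order effect; dividing by \<open>s\<close> and
  letting \<open>s\<close> tend to 0 turns the perturbation into \<open>D\<close> on
  \<open>{k > m}\<close>.\<close>

lemma isotonic_min_level_upper:
  assumes l: "square_integrable l" and k: "isotonic_min l k"
    and D: "\<And>u v. u \<in> {0<..<1} \<Longrightarrow> v \<in> {0<..<1} \<Longrightarrow> u \<le> v \<Longrightarrow> D v \<le> D u"
      "\<And>u. u \<in> {0<..<1} \<Longrightarrow> continuous (at_left u) D"
      "\<And>u. 0 \<le> D u" "\<And>u. D u \<le> (1 :: real)"
  shows "0 \<le> (\<integral>u. of_bool (m < k u) * D u * (l u - m) \<partial>unif)"
proof -
  have c: "k \<in> isotonic_cone" using k unfolding isotonic_min_def by auto
  note sk = isotonic_cone_square_integrable[OF c]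
  have [measurable]: "l \<in> borel_measurable unif" "k \<in> borel_measurable unif"
    using l sk unfolding square_integrable_def by auto
  have "mono_on {0<..<1} (\<lambda>u. - D u)" using D(1) by (auto simp: mono_on_def)
  then have "(\<lambda>u. - (- D u)) \<in> borel_measurable unif"
    by (intro borel_measurable_uminus mono_on_unif_measurable)
  then have [measurable]: "D \<in> borel_measurable unif" by simp
  have sD: "square_integrable D"
    unfolding square_integrable_def
    using D(3,4) by (auto intro!: unif.integrable_const_bound[where B = 1] simp: power_le_one abs_of_nonneg)
  have nn: "0 \<le> (\<integral>u. max 0 (min (D u) (real (Suc n) * (k u - m))) * (l u - m) \<partial>unif)" for n
  proof -
    define s where "s = 1 / real (Suc n)"
    have s: "0 < s" by (simp add: s_def)
    define w where "w = (\<lambda>u. max 0 (min (s * D u) (k u - m)))"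
    have sw: "square_integrable w"
      unfolding w_def
      by (intro square_integrable_max square_integrable_min square_integrable_const
          square_integrable_cmult square_integrable_diff sD sk)
    have "(\<lambda>u. min (k u) (max (k u + s * - D u) m)) \<in> isotonic_cone"
    proof (intro isotonic_cone_min isotonic_cone_max isotonic_cone_const isotonic_cone_add c isotonic_cone_scale)
      show "(\<lambda>u. - D u) \<in> isotonic_cone"
        using D sD square_integrable_cmult[OF sD, of "- 1"]
        by (intro isotonic_coneI continuous_minus) (auto simp: mono_on_def)
    qed (use s in auto)
    moreover have "min (k u) (max (k u + s * - D u) m) = k u + - w u" for u
    proof -
      have "min x (max (x + - y) m) = x + - max 0 (min y (x - m))" if "0 \<le> y" for x y :: real
        using that by (auto simp: min_def max_def)
      from this[of "s * D u" "k u"] show ?thesis using s D(3)[of u] by (simp add: w_def)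
    qed
    ultimately have "(\<lambda>u. k u + - w u) \<in> isotonic_cone" by simp
    then have "0 \<le> (\<integral>u. (- w u)\<^sup>2 + 2 * (- w u * (k u - l u)) \<partial>unif)"
      using isotonic_min_variation[OF l k, of "\<lambda>u. - w u"] square_integrable_cmult[OF sw, of "- 1"] by simp
    also have "\<dots> \<le> (\<integral>u. 2 * (w u * (l u - m)) \<partial>unif)"
    proof (rule integral_mono)
      show "integrable unif (\<lambda>u. (- w u)\<^sup>2 + 2 * (- w u * (k u - l u)))"
        using square_integrable_power2[OF sw] square_integrable_mult[OF sw square_integrable_diff[OF sk l]] by simp
      show "integrable unif (\<lambda>u. 2 * (w u * (l u - m)))"
        using square_integrable_mult[OF sw square_integrable_diff[OF l square_integrable_const]] by simp
      show "(- w u)\<^sup>2 + 2 * (- w u * (k u - l u)) \<le> 2 * (w u * (l u - m))" for u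
      proof -
        \<comment> \<open>Where \<open>w\<close> is positive it is at most \<open>k - m\<close>.
          This lets \<open>k\<close> be replaced by the constant \<open>m\<close> in the first-order
          term and absorbs the quadratic term.\<close>
        have "w u * w u \<le> w u * (k u - m)"
          by (cases "w u = 0") (auto simp: w_def intro!: mult_left_mono split: if_splits)
        moreover have "2 * (w u * (l u - m)) - ((- w u)\<^sup>2 + 2 * (- w u * (k u - l u)))
            = 2 * (w u * (k u - m)) - w u * w u"
          by (simp add: power2_eq_square algebra_simps)
        moreover have "0 \<le> w u * w u" by simp
        ultimately show ?thesis by linarith
      qed
    qed
    finally have "0 \<le> (\<integral>u. w u * (l u - m) \<partial>unif)" by simp
    \<comment> \<open>The factor is \<open>1 / s\<close>; it rescales \<open>w\<close> to a
      perturbation bounded by \<open>D\<close>, hence by 1, whatever \<open>n\<close> is.\<close>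
    then have "0 \<le> real (Suc n) * (\<integral>u. w u * (l u - m) \<partial>unif)" by simp
    also have "\<dots> = (\<integral>u. real (Suc n) * (w u * (l u - m)) \<partial>unif)" by simp
    also have "(\<lambda>u. real (Suc n) * (w u * (l u - m))) =
        (\<lambda>u. max 0 (min (D u) (real (Suc n) * (k u - m))) * (l u - m))"
    proof
      fix u
      have "real (Suc n) * w u = max 0 (min (D u) (real (Suc n) * (k u - m)))"
        unfolding w_def s_def
        by (simp add: max_mult_distrib_left min_mult_distrib_left del: of_nat_Suc)
      then show "real (Suc n) * (w u * (l u - m)) = max 0 (min (D u) (real (Suc n) * (k u - m))) * (l u - m)"
        by (metis mult.assoc)
    qed
    finally show ?thesis .
  qed
  have "(\<lambda>n. \<integral>u. max 0 (min (D u) (real (Suc n) * (k u - m))) * (l u - m) \<partial>unif)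
      \<longlonglongrightarrow> (\<integral>u. of_bool (m < k u) * D u * (l u - m) \<partial>unif)"
  proof (rule integral_dominated_convergence[where w = "\<lambda>u. \<bar>l u - m\<bar>"])
    show "integrable unif (\<lambda>u. \<bar>l u - m\<bar>)"
      using square_integrable_integrable[OF l] by auto
    have "(\<lambda>n. max 0 (min (D u) (real (Suc n) * (k u - m)))) \<longlonglongrightarrow> of_bool (m < k u) * D u" for u
      using truncated_scaling_tendsto[OF D(3)[of u], of "k u - m"] by (simp del: of_nat_Suc)
    then show "AE u in unif. (\<lambda>n. max 0 (min (D u) (real (Suc n) * (k u - m))) * (l u - m))
        \<longlonglongrightarrow> of_bool (m < k u) * D u * (l u - m)"
      by (intro AE_I2 tendsto_mult_right)
    have "\<bar>max 0 (min (D u) x)\<bar> \<le> 1" for u x using D(3,4)[of u] by auto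
    then show "AE u in unif. norm (max 0 (min (D u) (real (Suc n) * (k u - m))) * (l u - m)) \<le> \<bar>l u - m\<bar>" for n
      by (intro AE_I2) (simp add: abs_mult mult_left_le_one_le del: of_nat_Suc)
  qed measurable
  then show ?thesis using nn by (intro LIMSEQ_le_const) auto
qed

text \<open>The mirror image: \<open>k\<close> is raised by \<open>s * D\<close>, but never above
  \<open>m\<close>, which keeps it in the cone when \<open>D\<close> is increasing.\<close>

lemma isotonic_min_level_lower:
  assumes l: "square_integrable l" and k: "isotonic_min l k"
    and D: "mono_on {0<..<1} D" "\<And>u. u \<in> {0<..<1} \<Longrightarrow> continuous (at_left u) D"
      "\<And>u. 0 \<le> D u" "\<And>u. D u \<le> (1 :: real)"
  shows "0 \<le> (\<integral>u. of_bool (k u < m) * D u * (m - l u) \<partial>unif)"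
proof -
  have c: "k \<in> isotonic_cone" using k unfolding isotonic_min_def by auto
  note sk = isotonic_cone_square_integrable[OF c]
  have [measurable]: "l \<in> borel_measurable unif" "k \<in> borel_measurable unif"
    using l sk unfolding square_integrable_def by auto
  have [measurable]: "D \<in> borel_measurable unif" using D(1) by (rule mono_on_unif_measurable)
  have sD: "square_integrable D"
    unfolding square_integrable_def
    using D(3,4) by (auto intro!: unif.integrable_const_bound[where B = 1] simp: power_le_one abs_of_nonneg)
  have nn: "0 \<le> (\<integral>u. max 0 (min (D u) (real (Suc n) * (m - k u))) * (m - l u) \<partial>unif)" for n
  proof -
    define s where "s = 1 / real (Suc n)"
    have s: "0 < s" by (simp add: s_def)
    define w where "w = (\<lambda>u. max 0 (min (s * D u) (m - k u)))"
    have sw: "square_integrable w"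
      unfolding w_def
      by (intro square_integrable_max square_integrable_min square_integrable_const
          square_integrable_cmult square_integrable_diff sD sk)
    have "(\<lambda>u. max (k u) (min (k u + s * D u) m)) \<in> isotonic_cone"
      using D sD s
      by (intro isotonic_cone_min isotonic_cone_max isotonic_cone_const isotonic_cone_add c
          isotonic_cone_scale isotonic_coneI) auto
    moreover have "max (k u) (min (k u + s * D u) m) = k u + w u" for u
    proof -
      have "max x (min (x + y) m) = x + max 0 (min y (m - x))" if "0 \<le> y" for x y :: real
        using that by (auto simp: min_def max_def)
      from this[of "s * D u" "k u"] show ?thesis using s D(3)[of u] by (simp add: w_def)
    qed
    ultimately have "(\<lambda>u. k u + w u) \<in> isotonic_cone" by simp
    then have "0 \<le> (\<integral>u. (w u)\<^sup>2 + 2 * (w u * (k u - l u)) \<partial>unif)"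
      using isotonic_min_variation[OF l k sw] by simp
    also have "\<dots> \<le> (\<integral>u. 2 * (w u * (m - l u)) \<partial>unif)"
    proof (rule integral_mono)
      show "integrable unif (\<lambda>u. (w u)\<^sup>2 + 2 * (w u * (k u - l u)))"
        using square_integrable_power2[OF sw] square_integrable_mult[OF sw square_integrable_diff[OF sk l]] by simp
      show "integrable unif (\<lambda>u. 2 * (w u * (m - l u)))"
        using square_integrable_mult[OF sw square_integrable_diff[OF square_integrable_const l]] by simp
      show "(w u)\<^sup>2 + 2 * (w u * (k u - l u)) \<le> 2 * (w u * (m - l u))" for u
      proof -
        have "w u * w u \<le> w u * (m - k u)"
          by (cases "w u = 0") (auto simp: w_def intro!: mult_left_mono split: if_splits)
        moreover have "2 * (w u * (m - l u)) - ((w u)\<^sup>2 + 2 * (w u * (k u - l u)))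
            = 2 * (w u * (m - k u)) - w u * w u"
          by (simp add: power2_eq_square algebra_simps)
        moreover have "0 \<le> w u * w u" by simp
        ultimately show ?thesis by linarith
      qed
    qed
    finally have "0 \<le> (\<integral>u. w u * (m - l u) \<partial>unif)" by simp
    then have "0 \<le> real (Suc n) * (\<integral>u. w u * (m - l u) \<partial>unif)" by simp
    also have "\<dots> = (\<integral>u. real (Suc n) * (w u * (m - l u)) \<partial>unif)" by simp
    also have "(\<lambda>u. real (Suc n) * (w u * (m - l u))) =
        (\<lambda>u. max 0 (min (D u) (real (Suc n) * (m - k u))) * (m - l u))"
    proof
      fix u
      have "real (Suc n) * w u = max 0 (min (D u) (real (Suc n) * (m - k u)))"
        unfolding w_def s_def
        by (simp add: max_mult_distrib_left min_mult_distrib_left del: of_nat_Suc)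
      then show "real (Suc n) * (w u * (m - l u)) = max 0 (min (D u) (real (Suc n) * (m - k u))) * (m - l u)"
        by (metis mult.assoc)
    qed
    finally show ?thesis .
  qed
  have "(\<lambda>n. \<integral>u. max 0 (min (D u) (real (Suc n) * (m - k u))) * (m - l u) \<partial>unif)
      \<longlonglongrightarrow> (\<integral>u. of_bool (k u < m) * D u * (m - l u) \<partial>unif)"
  proof (rule integral_dominated_convergence[where w = "\<lambda>u. \<bar>m - l u\<bar>"])
    show "integrable unif (\<lambda>u. \<bar>m - l u\<bar>)"
      using square_integrable_integrable[OF l] by auto
    have "(\<lambda>n. max 0 (min (D u) (real (Suc n) * (m - k u)))) \<longlonglongrightarrow> of_bool (k u < m) * D u" for u
      using truncated_scaling_tendsto[OF D(3)[of u], of "m - k u"] by (simp del: of_nat_Suc)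
    then show "AE u in unif. (\<lambda>n. max 0 (min (D u) (real (Suc n) * (m - k u))) * (m - l u))
        \<longlonglongrightarrow> of_bool (k u < m) * D u * (m - l u)"
      by (intro AE_I2 tendsto_mult_right)
    have "\<bar>max 0 (min (D u) x)\<bar> \<le> 1" for u x using D(3,4)[of u] by auto
    then show "AE u in unif. norm (max 0 (min (D u) (real (Suc n) * (m - k u))) * (m - l u)) \<le> \<bar>m - l u\<bar>" for n
      by (intro AE_I2) (simp add: abs_mult mult_left_le_one_le del: of_nat_Suc)
  qed measurable
  then show ?thesis using nn by (intro LIMSEQ_le_const) auto
qed

section \<open>Existence of the projection\<close>

lemma square_dist_nonneg: "0 \<le> square_dist l j"
  unfolding square_dist_def by (rule integral_nonneg_AE) simp

text \<open>A minimising sequence is chosen within \<open>(1/4)^n\<close> of the infimum. The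
  parallelogram law makes the squared gaps between consecutive terms geometrically small, so the
  gaps are summable almost everywhere and the sequence converges there. The limit has a
  left-continuous monotone version, and Fatou's lemma shows that it attains the infimum.\<close>

lemma isotonic_min_exists:
  assumes l: "square_integrable l"
  obtains k where "isotonic_min l k"
proof -
  define D where "D = (INF j\<in>isotonic_cone. square_dist l j)"
  have bdd: "bdd_below (square_dist l ` isotonic_cone)"
    using square_dist_nonneg by (intro bdd_belowI[of _ 0]) auto
  have Dle: "D \<le> square_dist l j" if "j \<in> isotonic_cone" for j
    unfolding D_def by (rule cINF_lower[OF bdd that])
  have "\<exists>j\<in>isotonic_cone. square_dist l j < D + (1/4) ^ n" for n
  proof -
    have "D < D + (1/4) ^ n" by simp
    then show ?thesis
      unfolding D_def using isotonic_cone_const by (subst (asm) cINF_less_iff[OF _ bdd]) auto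
  qed
  then obtain j where jc: "j n \<in> isotonic_cone" and jD: "square_dist l (j n) < D + (1/4) ^ n" for n
    by metis
  note sj = isotonic_cone_square_integrable[OF jc]
  have meas [measurable]: "l \<in> borel_measurable unif" "j n \<in> borel_measurable unif" for n
    using l sj[of n] unfolding square_integrable_def by auto
  have gap: "(\<integral>u. (j (Suc n) u - j n u)\<^sup>2 \<partial>unif) \<le> 4 * (1/4) ^ n" for n
  proof -
    define m where "m = (\<lambda>u. 1/2 * (j (Suc n) u + j n u))"
    have 1: "square_dist (j n) (j (Suc n)) = 2 * square_dist l (j (Suc n)) + 2 * square_dist l (j n) - 4 * square_dist l m"
      unfolding m_def by (rule parallelogram[OF l sj sj])
    have 2: "D \<le> square_dist l m"
      unfolding m_def by (rule Dle[OF isotonic_cone_midpoint[OF jc jc]])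
    have "square_dist (j n) (j (Suc n)) \<le> 2 * (D + (1/4) ^ Suc n) + 2 * (D + (1/4) ^ n) - 4 * D"
      using 1 2 less_imp_le[OF jD[of n]] less_imp_le[OF jD[of "Suc n"]] by argo
    also have "\<dots> \<le> 4 * (1/4) ^ n" by simp
    finally show ?thesis unfolding square_dist_def .
  qed
  have gap1: "(\<integral>\<^sup>+u. ennreal \<bar>j (Suc n) u - j n u\<bar> \<partial>unif) \<le> ennreal (3 * (1/2) ^ n)" for n
  proof -
    \<comment> \<open>The weight in the inequality between arithmetic and geometric mean. With
      \<open>2^n\<close> both resulting terms are of order \<open>(1/2)^n\<close>, so the gaps have
      a summable bound.\<close>
    define c :: real where "c = 2 ^ n"
    have c: "0 < c" by (simp add: c_def)
    have amgm: "\<bar>x\<bar> \<le> c * x\<^sup>2 / 2 + 1 / c / 2" for x :: real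
    proof -
      have "0 \<le> (c * \<bar>x\<bar> - 1)\<^sup>2 / (2 * c)" using c by simp
      also have "\<dots> = c * x\<^sup>2 / 2 + 1 / c / 2 - \<bar>x\<bar>"
        using c by (simp add: power2_diff power_mult_distrib field_simps) (simp add: power2_eq_square)
      finally show ?thesis by simp
    qed
    have I: "integrable unif (\<lambda>u. (j (Suc n) u - j n u)\<^sup>2)"
      by (rule square_integrable_power2[OF square_integrable_diff[OF sj sj]])
    have I2: "integrable unif (\<lambda>u. c * (j (Suc n) u - j n u)\<^sup>2 / 2 + 1 / c / 2)"
      using I by auto
    have prob: "measure unif {0<..<1} = 1" using unif.prob_space by simp
    have "(\<integral>\<^sup>+u. ennreal \<bar>j (Suc n) u - j n u\<bar> \<partial>unif)
        \<le> (\<integral>\<^sup>+u. ennreal (c * (j (Suc n) u - j n u)\<^sup>2 / 2 + 1 / c / 2) \<partial>unif)"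
      by (intro nn_integral_mono ennreal_leI amgm)
    also have "\<dots> = ennreal (\<integral>u. c * (j (Suc n) u - j n u)\<^sup>2 / 2 + 1 / c / 2 \<partial>unif)"
      using c by (intro nn_integral_eq_integral[OF I2] AE_I2) simp
    also have "(\<integral>u. c * (j (Suc n) u - j n u)\<^sup>2 / 2 + 1 / c / 2 \<partial>unif)
        = c * (\<integral>u. (j (Suc n) u - j n u)\<^sup>2 \<partial>unif) / 2 + 1 / c / 2"
      using I prob by simp
    also have "\<dots> \<le> c * (4 * (1/4) ^ n) / 2 + 1 / c / 2"
      using gap[of n] c by (intro add_mono divide_right_mono mult_left_mono) auto
    also have "\<dots> \<le> 3 * (1/2) ^ n"
    proof -
      have "(4 :: real) ^ n = 2 ^ n * 2 ^ n" by (simp flip: power_mult_distrib)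
      then show ?thesis unfolding c_def by (simp add: power_one_over field_simps)
    qed
    finally show ?thesis by (simp add: ennreal_leI)
  qed
  have "(\<integral>\<^sup>+u. (\<Sum>n. ennreal \<bar>j (Suc n) u - j n u\<bar>) \<partial>unif)
      = (\<Sum>n. \<integral>\<^sup>+u. ennreal \<bar>j (Suc n) u - j n u\<bar> \<partial>unif)"
    by (rule nn_integral_suminf) measurable
  also have "\<dots> \<le> (\<Sum>n. ennreal (3 * (1/2) ^ n))"
    by (intro suminf_le gap1 summableI)
  also have "\<dots> = ennreal (\<Sum>n. 3 * (1/2) ^ n)"
    by (intro suminf_ennreal2) (auto intro!: summable_mult summable_geometric)
  also have "\<dots> < \<infinity>" by simp
  finally have "AE u in unif. (\<Sum>n. ennreal \<bar>j (Suc n) u - j n u\<bar>) \<noteq> \<infinity>"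
    by (intro nn_integral_PInf_AE) (auto simp: less_top)
  then have conv: "AE u in unif. convergent (\<lambda>n. j n u)"
  proof (rule AE_mp, intro AE_I2 impI)
    fix u assume fin: "(\<Sum>n. ennreal \<bar>j (Suc n) u - j n u\<bar>) \<noteq> \<infinity>"
    have "summable (\<lambda>n. \<bar>j (Suc n) u - j n u\<bar>)"
      using fin by (intro summable_suminf_not_top) (auto simp: top_ennreal_def)
    then have "summable (\<lambda>n. j (Suc n) u - j n u)" by (rule summable_rabs_cancel)
    then have "convergent (\<lambda>n. \<Sum>i<n. j (Suc i) u - j i u)" by (simp add: summable_iff_convergent)
    then have "convergent (\<lambda>n. j n u - j 0 u)" by (simp only: sum_lessThan_telescope[where f = "\<lambda>i. j i u"])
    then have "convergent (\<lambda>n. j n u - j 0 u + j 0 u)" by (intro convergent_add convergent_const)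
    then show "convergent (\<lambda>n. j n u)" by simp
  qed
  define S where "S = {u \<in> {0<..<1}. convergent (\<lambda>n. j n u)}"
  have S_lim: "(\<lambda>n. j n u) \<longlonglongrightarrow> lim (\<lambda>n. j n u)" if "u \<in> S" for u
    using that unfolding S_def by (simp add: convergent_LIMSEQ_iff)
  have lim_mono: "lim (\<lambda>n. j n u) \<le> lim (\<lambda>n. j n v)" if "u \<in> S" "v \<in> S" "u \<le> v" for u v
    using that mono_onD[OF isotonic_coneD(1)[OF jc], of u v] unfolding S_def
    by (intro LIMSEQ_le[OF S_lim S_lim]) (auto simp: S_def)
  have S_dense: "\<exists>v\<in>S. x < v \<and> v < y" if "0 \<le> x" "x < y" "y \<le> 1" for x y
  proof -
    obtain v where "x < v" "v < y" "convergent (\<lambda>n. j n v)"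
      using AE_unif_interval[OF conv \<open>0 \<le> x\<close> \<open>x < y\<close> \<open>y \<le> 1\<close>] .
    then show ?thesis using \<open>0 \<le> x\<close> \<open>y \<le> 1\<close> unfolding S_def by (intro bexI[of _ v]) auto
  qed
  \<comment> \<open>The limit exists only on the dense set \<open>S\<close>. The supremum over the
    points of \<open>S\<close> to the left extends it monotonically to the whole interval.\<close>
  define g where "g u = (SUP v\<in>{v \<in> S. v \<le> u}. lim (\<lambda>n. j n v))" for u
  have bdd_g: "bdd_above ((\<lambda>v. lim (\<lambda>n. j n v)) ` {v \<in> S. v \<le> u})" if u: "u \<in> {0<..<1}" for u
  proof -
    obtain w where "w \<in> S" "u < w" using S_dense[of u 1] u by auto
    then show ?thesis by (intro bdd_aboveI[of _ "lim (\<lambda>n. j n w)"]) (auto intro: lim_mono)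
  qed
  have g_mono: "mono_on {0<..<1} g"
  proof (rule mono_onI)
    fix u v :: real assume uv: "u \<in> {0<..<1}" "v \<in> {0<..<1}" "u \<le> v"
    obtain w where "w \<in> S" "w < u" using S_dense[of 0 u] uv by auto
    then show "g u \<le> g v"
      unfolding g_def using uv by (intro cSUP_subset_mono bdd_g) auto
  qed
  have g_lim: "g u = lim (\<lambda>n. j n u)" if "u \<in> S" for u
    unfolding g_def using that by (intro cSup_eq_maximum) (auto intro: lim_mono)
  \<comment> \<open>The quantile function of the law of \<open>g\<close> is its left-continuous
    version, as membership in the cone requires.\<close>
  define k where "k = quantile (cdf (distr unif borel g))"
  have cdf: "is_cdf (cdf (distr unif borel g))"
    using distr_unif_mono(1)[OF g_mono] unfolding is_cdf_def by blast
  have kmono: "mono_on {0<..<1} k" and kcont: "\<And>u. u \<in> {0<..<1} \<Longrightarrow> continuous (at_left u) k"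
    unfolding k_def using quantile_mono[OF cdf] quantile_continuous_at_left[OF cdf] by auto
  have [measurable]: "k \<in> borel_measurable unif" by (rule mono_on_unif_measurable[OF kmono])
  have klim: "AE u in unif. (\<lambda>n. j n u) \<longlonglongrightarrow> k u"
    using quantile_distr_unif_AE[OF g_mono] conv AE_space[of unif]
  proof eventually_elim
    case (elim u)
    then have "u \<in> S" by (simp add: S_def)
    then show ?case using S_lim[of u] g_lim[of u] elim(1) by (simp add: k_def)
  qed
  have "(\<integral>\<^sup>+u. ennreal ((k u - l u)\<^sup>2) \<partial>unif)
      = (\<integral>\<^sup>+u. liminf (\<lambda>n. ennreal ((j n u - l u)\<^sup>2)) \<partial>unif)"
  proof (rule nn_integral_cong_AE)
    show "AE u in unif. ennreal ((k u - l u)\<^sup>2) = liminf (\<lambda>n. ennreal ((j n u - l u)\<^sup>2))"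
      using klim
    proof eventually_elim
      case (elim u)
      then have "(\<lambda>n. ennreal ((j n u - l u)\<^sup>2)) \<longlonglongrightarrow> ennreal ((k u - l u)\<^sup>2)"
        by (intro tendsto_ennrealI tendsto_intros)
      then show ?case by (intro lim_imp_Liminf[symmetric]) auto
    qed
  qed
  also have "\<dots> \<le> liminf (\<lambda>n. \<integral>\<^sup>+u. ennreal ((j n u - l u)\<^sup>2) \<partial>unif)"
    by (rule nn_integral_liminf) measurable
  also have "\<dots> \<le> liminf (\<lambda>n. ennreal (D + (1/4) ^ n))"
  proof (intro Liminf_mono always_eventually allI)
    fix n
    have "(\<integral>\<^sup>+u. ennreal ((j n u - l u)\<^sup>2) \<partial>unif) = ennreal (square_dist l (j n))"
      unfolding square_dist_def
      by (intro nn_integral_eq_integral square_integrable_power2 square_integrable_diff sj l) auto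
    then show "(\<integral>\<^sup>+u. ennreal ((j n u - l u)\<^sup>2) \<partial>unif) \<le> ennreal (D + (1/4) ^ n)"
      using jD[of n] by (simp add: ennreal_leI)
  qed
  also have "\<dots> = ennreal D"
  proof (intro lim_imp_Liminf)
    have "(\<lambda>n. D + (1/4) ^ n) \<longlonglongrightarrow> D + 0"
      by (intro tendsto_intros LIMSEQ_power_zero) simp
    then show "(\<lambda>n. ennreal (D + (1/4) ^ n)) \<longlonglongrightarrow> ennreal D"
      by (intro tendsto_ennrealI) simp
  qed simp
  \<comment> \<open>Non-negative integrals are used up to here because square integrability of
    \<open>k\<close> is not known beforehand; it is a consequence of this bound.\<close>
  finally have bound: "(\<integral>\<^sup>+u. ennreal ((k u - l u)\<^sup>2) \<partial>unif) \<le> ennreal D" .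
  have skl: "square_integrable (\<lambda>u. k u - l u)"
    unfolding square_integrable_def
    using bound by (auto intro!: integrableI_nonneg intro: le_less_trans)
  have D0: "0 \<le> D" unfolding D_def using isotonic_cone_const square_dist_nonneg by (intro cINF_greatest) auto
  have "ennreal (square_dist l k) \<le> ennreal D"
    using bound nn_integral_eq_integral[OF square_integrable_power2[OF skl]] unfolding square_dist_def by simp
  then have "square_dist l k \<le> D" using D0 by simp
  moreover have "k \<in> isotonic_cone"
    using square_integrable_add[OF skl l] by (intro isotonic_coneI kmono kcont) auto
  ultimately have "isotonic_min l k"
    unfolding isotonic_min_def using Dle by (auto intro: order_trans)
  then show ?thesis by (rule that)
qed

lemma isotonic_min_proj:
  assumes "square_integrable l"
  shows "isotonic_min l (isotonic_proj l)"
proof -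
  have eq: "is_arg_min (\<lambda>j. \<integral>u. (j u - l u)\<^sup>2 \<partial>unif) (\<lambda>j. j \<in> isotonic_cone) k \<longleftrightarrow> isotonic_min l k" for k
    unfolding is_arg_min_def isotonic_min_def square_dist_def by (auto simp: not_less)
  obtain k where "isotonic_min l k" using isotonic_min_exists[OF assms] .
  then show ?thesis
    unfolding isotonic_proj_def arg_min_on_def arg_min_def eq by (rule someI[of "isotonic_min l"])
qed

section \<open>The weight of a signed Choquet integral\<close>

text \<open>The representation is tested on the Bernoulli law with success probability
  \<open>s\<close>, whose Choquet integral is \<open>h s\<close>. This recovers the distortion
  function from its weight.\<close>

lemma distortion_eq_integral_weight:
  fixes s :: real
  assumes s: "0 < s" "s \<le> 1" and w: "weight_representation p h \<gamma>" and h0: "h 0 = 0"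
  shows "integrable unif (\<lambda>u. \<gamma> u * indicator {1 - s<..<1} u)"
    and "h s = (\<integral>u. \<gamma> u * indicator {1 - s<..<1} u \<partial>unif)"
proof -
  \<comment> \<open>Excluding the endpoint \<open>1 - s\<close> makes the function left-continuous,
    so it is the Bernoulli quantile function on the unit interval.\<close>
  define g :: "real \<Rightarrow> real" where "g = indicator {1 - s<..}"
  have g: "mono_on {0<..<1} g"
    by (auto simp: g_def mono_on_def indicator_def)
  have [measurable]: "g \<in> borel_measurable unif" by (rule mono_on_unif_measurable[OF g])
  have cont: "continuous (at_left u) g" if "u \<in> {0<..<1}" for u
  proof (rule continuous_at_leftI_mono[OF g that])
    fix x assume x: "x < g u"
    show "\<exists>v\<in>{0<..<u}. x < g v"
    proof (cases "u > 1 - s")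
      case True
      then obtain v where v: "max 0 (1 - s) < v" "v < u"
        using dense[of "max 0 (1 - s)" u] \<open>u \<in> _\<close> by auto
      then show ?thesis using x True by (intro bexI[of _ v]) (auto simp: g_def)
    next
      case False
      then show ?thesis using x that by (intro bexI[of _ "u/2"]) (auto simp: g_def indicator_def)
    qed
  qed
  define q where "q = quantile (cdf (distr unif borel g))"
  have q: "q u = g u" if "0 < u" "u < 1" for u
    unfolding q_def using quantile_distr_unif[OF g _ cont] that by simp
  have [measurable]: "(\<lambda>u. \<bar>g u\<bar> powr p) \<in> borel_measurable unif" by measurable
  have "integrable unif (\<lambda>u. \<bar>g u\<bar> powr p)"
    by (intro unif.integrable_const_bound[where B = 1] AE_I2) (simp add: g_def indicator_def, measurable)
  then have G: "cdf (distr unif borel g) \<in> moment_cdfs p"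
    by (rule moment_cdfs_distr_unif[OF g])
  have up: "upper_prob unif q x = (if x \<le> 0 then 1 else if x \<le> 1 then s else 0)" for x
  proof -
    have eq: "{u \<in> space unif. x \<le> q u} =
        (if x \<le> 0 then {0<..<1} else if x \<le> 1 then {1 - s<..<1} else {})"
      using s by (auto simp: q g_def indicator_def of_bool_def split: if_splits)
    have "upper_prob unif q x = measure unif (if x \<le> 0 then {0<..<1} else if x \<le> 1 then {1 - s<..<1} else {})"
      unfolding upper_prob_def eq ..
    also have "\<dots> = (if x \<le> 0 then 1 else if x \<le> 1 then s else 0)"
      using s by (auto simp: measure_unif subset_eq)
    finally show ?thesis .
  qed
  have low: "indicator {..0} x *\<^sub>R (h (upper_prob unif q x) - h 1) = 0" for x :: real
    by (simp add: up indicator_def)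
  \<comment> \<open>The identity can fail only at 0, where the upper probability is 1 instead of
    \<open>s\<close>.\<close>
  have high: "AE x in lborel. indicator {0..} x *\<^sub>R h (upper_prob unif q x) = h s * indicator {0..1} x"
    using AE_lborel_singleton[of 0]
    by eventually_elim (auto simp: up indicator_def h0)
  have meas: "(\<lambda>x. indicator {0..} x *\<^sub>R h (upper_prob unif q x)) \<in> borel_measurable lborel"
    unfolding up by measurable
  have fin: "choquet_finite h unif q"
  proof -
    have "integrable lborel (\<lambda>x. indicator {0..} x *\<^sub>R h (upper_prob unif q x))"
      by (subst integrable_cong_AE[OF meas _ high]) auto
    then show ?thesis
      unfolding choquet_finite_def set_integrable_def low by simp
  qed
  have "choquet_quantile h q = (\<integral>x. h s * indicator {0..1 :: real} x \<partial>lborel)"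
    unfolding choquet_quantile_def signed_choquet_def set_lebesgue_integral_def low
    by (subst integral_cong_AE[OF meas _ high]) auto
  then have val: "choquet_quantile h q = h s" by simp
  have "integrable unif (\<lambda>u. \<gamma> u * q u) \<and> choquet_quantile h q = (\<integral>u. \<gamma> u * q u \<partial>unif)"
    using w G fin unfolding weight_representation_def q_def by blast
  moreover have "integrable unif (\<lambda>u. \<gamma> u * q u) = integrable unif (\<lambda>u. \<gamma> u * indicator {1 - s<..<1} u)"
    by (rule Bochner_Integration.integrable_cong) (simp_all add: q g_def indicator_def)
  moreover have "(\<integral>u. \<gamma> u * q u \<partial>unif) = (\<integral>u. \<gamma> u * indicator {1 - s<..<1} u \<partial>unif)"
    by (rule Bochner_Integration.integral_cong) (simp_all add: q g_def indicator_def)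
  ultimately show "integrable unif (\<lambda>u. \<gamma> u * indicator {1 - s<..<1} u)"
    and "h s = (\<integral>u. \<gamma> u * indicator {1 - s<..<1} u \<partial>unif)"
    using val by simp_all
qed

text \<open>The case \<open>s = 1\<close>, where the indicator equals 1 on the whole
  interval.\<close>

lemma weight_integrable:
  assumes "weight_representation p h \<gamma>" "h 0 = 0"
  shows "integrable unif \<gamma>"
proof -
  have "integrable unif (\<lambda>u. \<gamma> u * indicator {1 - 1<..<1} u) = integrable unif \<gamma>"
    by (rule Bochner_Integration.integrable_cong) auto
  then show ?thesis
    using distortion_eq_integral_weight(1)[of 1, OF _ _ assms] by simp
qed

text \<open>A weight that vanishes almost everywhere would make \<open>h\<close> zero on the unit
  interval, against non-constancy. This later excludes degenerate multipliers and coincidence of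
  candidates with different multipliers.\<close>

lemma weight_nontrivial:
  assumes "weight_representation p h \<gamma>" "distortion h"
  shows "\<not> (AE u in unif. \<gamma> u = 0)"
proof
  assume z: "AE u in unif. \<gamma> u = 0"
  have h0: "h 0 = 0" using assms(2) by (simp add: distortion_def)
  have [measurable]: "\<gamma> \<in> borel_measurable unif"
    using weight_integrable[OF assms(1) h0] by (rule borel_measurable_integrable)
  have "h s = 0" if "s \<in> {0..1}" for s
  proof (cases "s = 0")
    case False
    have "h s = (\<integral>u. \<gamma> u * indicator {1 - s<..<1} u \<partial>unif)"
      using distortion_eq_integral_weight(2)[OF _ _ assms(1) h0, of s] that False by simp
    also have "\<dots> = 0"
      using z by (intro integral_eq_zero_AE) (auto elim!: eventually_mono)
    finally show ?thesis .
  qed (simp add: h0)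
  then have "h constant_on {0..1}" unfolding constant_on_def by blast
  then show False using assms(2) by (simp add: distortion_def)
qed

section \<open>Lagrange multipliers and first-order conditions\<close>

text \<open>A crude bound through the maximum is enough, as it only has to transfer
  integrability.\<close>

lemma abs_powr_convex_combination:
  fixes x y p :: real
  assumes "0 \<le> t" "t \<le> 1" "1 \<le> p"
  shows "\<bar>(1 - t) * x + t * y\<bar> powr p \<le> \<bar>x\<bar> powr p + \<bar>y\<bar> powr p"
proof -
  have "\<bar>(1 - t) * x + t * y\<bar> \<le> (1 - t) * \<bar>x\<bar> + t * \<bar>y\<bar>"
    using assms abs_triangle_ineq[of "(1 - t) * x" "t * y"] by (simp add: abs_mult)
  also have "\<dots> \<le> (1 - t) * max \<bar>x\<bar> \<bar>y\<bar> + t * max \<bar>x\<bar> \<bar>y\<bar>"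
    using assms by (intro add_mono mult_left_mono) auto
  also have "\<dots> = max \<bar>x\<bar> \<bar>y\<bar>" by (simp add: algebra_simps)
  finally have "\<bar>(1 - t) * x + t * y\<bar> powr p \<le> max \<bar>x\<bar> \<bar>y\<bar> powr p"
    using assms by (intro powr_mono2) auto
  also have "\<dots> \<le> \<bar>x\<bar> powr p + \<bar>y\<bar> powr p"
    by (auto simp: max_def)
  finally show ?thesis .
qed

lemma abs_powr_add_le:
  fixes x w p :: real
  assumes "\<bar>w\<bar> \<le> 1" "1 \<le> p"
  shows "\<bar>x + w\<bar> powr p \<le> 2 powr p * (\<bar>x\<bar> powr p + 1)"
proof -
  have "\<bar>x + w\<bar> \<le> 2 * max \<bar>x\<bar> 1" using assms by (auto simp: max_def)
  then have "\<bar>x + w\<bar> powr p \<le> (2 * max \<bar>x\<bar> 1) powr p"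
    using assms by (intro powr_mono2) auto
  also have "\<dots> = 2 powr p * max \<bar>x\<bar> 1 powr p"
    by (rule powr_mult)
  also have "\<dots> \<le> 2 powr p * (\<bar>x\<bar> powr p + 1)"
    by (intro mult_left_mono) (auto simp: max_def)
  finally show ?thesis .
qed

text \<open>The hypotheses common to both cases, with the two facts on \<open>\<gamma>\<close>
  derived above from the representation. Monotonicity or sign of \<open>\<gamma>\<close> is left to
  the individual lemmas.\<close>

locale worst_case_problem = bregman_generator \<phi> for \<phi> :: "real \<Rightarrow> real" +
  fixes h \<gamma> F :: "real \<Rightarrow> real" and p \<epsilon> :: real
  assumes p: "1 \<le> p"
    and repr: "weight_representation p h \<gamma>"
    and gamma_integrable: "integrable unif \<gamma>"
    and gamma_nontrivial: "\<not> (AE u in unif. \<gamma> u = 0)"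
    and F: "is_cdf F"
    and eps: "0 < \<epsilon>"
    and fin: "\<And>q. feasible p \<phi> F \<epsilon> q \<Longrightarrow> choquet_finite h unif q"
begin

section \<open>Admissible functions, gain and divergence\<close>

abbreviation f :: "real \<Rightarrow> real" where "f \<equiv> quantile F"
abbreviation \<Phi> :: "real \<Rightarrow> real" where "\<Phi> u \<equiv> d (f u)"
abbreviation worst :: "(real \<Rightarrow> real) \<Rightarrow> bool" where "worst \<equiv> worst_case_quantile p h \<phi> F \<epsilon>"

text \<open>Left continuity is not demanded, so that convex combinations and truncated perturbations
  stay in the class. The divergence has to be finite but not below \<open>\<epsilon>\<close>, as
  befits the domain of a Lagrangian.\<close>

definition admissible :: "(real \<Rightarrow> real) \<Rightarrow> bool" where
  "admissible g \<longleftrightarrow> mono_on {0<..<1} g \<and> integrable unif (\<lambda>u. \<bar>g u\<bar> powr p) \<and>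
     integrable unif (\<lambda>u. bregman \<phi> (g u) (f u)) \<and> integrable unif (\<lambda>u. \<gamma> u * g u)"

definition gain :: "(real \<Rightarrow> real) \<Rightarrow> real" where
  "gain g = (\<integral>u. \<gamma> u * g u \<partial>unif)"

definition divg :: "(real \<Rightarrow> real) \<Rightarrow> real" where
  "divg g = (\<integral>u. bregman \<phi> (g u) (f u) \<partial>unif)"

lemma measurable_f [measurable]: "f \<in> borel_measurable unif"
  by (rule mono_on_unif_measurable[OF quantile_mono[OF F]])

lemma measurable_\<gamma> [measurable]: "\<gamma> \<in> borel_measurable unif"
  using gamma_integrable by (rule borel_measurable_integrable)

lemma measurable_bregman [measurable]:
  assumes [measurable]: "g \<in> borel_measurable unif"
  shows "(\<lambda>u. bregman \<phi> (g u) (f u)) \<in> borel_measurable unif"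
  unfolding bregman_def by measurable

lemma \<Phi>_mono: "u \<in> {0<..<1} \<Longrightarrow> v \<in> {0<..<1} \<Longrightarrow> u \<le> v \<Longrightarrow> \<Phi> u \<le> \<Phi> v"
  using mono_onD[OF quantile_mono[OF F]] by simp

lemma bw_div_eq_divg:
  assumes "integrable unif (\<lambda>u. bregman \<phi> (g u) (f u))"
  shows "bw_div \<phi> g f = ennreal (divg g)"
  unfolding bw_div_def divg_def
  by (rule nn_integral_eq_integral[OF assms]) (simp add: bregman_nonneg)

lemma integrable_bregmanI:
  assumes [measurable]: "g \<in> borel_measurable unif" and "bw_div \<phi> g f < \<infinity>"
  shows "integrable unif (\<lambda>u. bregman \<phi> (g u) (f u))"
  using assms(2) unfolding bw_div_def
  by (intro integrableI_nonneg) (auto simp: bregman_nonneg)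

lemma divg_nonneg: "0 \<le> divg g"
  unfolding divg_def by (rule integral_nonneg_AE) (simp add: bregman_nonneg)

lemma feasible_admissible:
  assumes "feasible p \<phi> F \<epsilon> q"
  shows "admissible q" "divg q \<le> \<epsilon>" "choquet_quantile h q = gain q"
proof -
  obtain G where G: "G \<in> moment_cdfs p" "q = quantile G" and B: "bw_div \<phi> q f \<le> ennreal \<epsilon>"
    using assms unfolding feasible_def by blast
  have mono: "mono_on {0<..<1} q"
    using quantile_mono[OF moment_cdfs_is_cdf[OF G(1)]] G(2) by simp
  have "integrable unif (\<lambda>u. bregman \<phi> (q u) (f u))"
    using B by (intro integrable_bregmanI mono_on_unif_measurable[OF mono])
      (auto intro: le_less_trans)
  moreover have "integrable unif (\<lambda>u. \<gamma> u * q u) \<and> choquet_quantile h q = gain q"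
    using repr fin[OF assms] G unfolding weight_representation_def gain_def by blast
  ultimately show "admissible q" "choquet_quantile h q = gain q"
    using mono integrable_quantile_moment[OF G(1)] G(2) unfolding admissible_def by auto
  then show "divg q \<le> \<epsilon>"
    using B bw_div_eq_divg[of q] eps unfolding admissible_def by simp
qed

text \<open>The way back to quantile functions: passing to the quantile function of the law changes
  an admissible function on a null set only. Optimality thereby extends to all admissible functions,
  as \<open>worst_gain_ge\<close> records.\<close>

lemma admissible_feasible:
  assumes "admissible g" "divg g \<le> \<epsilon>"
  obtains g' where "feasible p \<phi> F \<epsilon> g'" "AE u in unif. g' u = g u"
proof -
  have g: "mono_on {0<..<1} g" "integrable unif (\<lambda>u. \<bar>g u\<bar> powr p)"
    and B: "integrable unif (\<lambda>u. bregman \<phi> (g u) (f u))"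
    using assms(1) unfolding admissible_def by auto
  let ?G = "cdf (distr unif borel g)"
  have "?G \<in> moment_cdfs p" by (rule moment_cdfs_distr_unif[OF g])
  moreover have AE: "AE u in unif. quantile ?G u = g u" by (rule quantile_distr_unif_AE[OF g(1)])
  moreover have "bw_div \<phi> (quantile ?G) f = bw_div \<phi> g f"
    unfolding bw_div_def using AE by (intro nn_integral_cong_AE) (auto elim: eventually_mono)
  then have "bw_div \<phi> (quantile ?G) f \<le> ennreal \<epsilon>"
    using bw_div_eq_divg[OF B] assms(2) by (simp add: ennreal_leI)
  ultimately show ?thesis
    using that[of "quantile ?G"] unfolding feasible_def by blast
qed

lemma gain_cong_AE:
  assumes "AE u in unif. g u = k u" "admissible g" "admissible k"
  shows "gain g = gain k"
  unfolding gain_def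
proof (rule integral_cong_AE)
  show "AE u in unif. \<gamma> u * g u = \<gamma> u * k u"
    using assms(1) by (auto elim: eventually_mono)
qed (use assms in \<open>auto simp: admissible_def\<close>)

lemma divg_cong_AE:
  assumes "AE u in unif. g u = k u" "admissible g" "admissible k"
  shows "divg g = divg k"
  unfolding divg_def
proof (rule integral_cong_AE)
  show "AE u in unif. bregman \<phi> (g u) (f u) = bregman \<phi> (k u) (f u)"
    using assms(1) by (auto elim: eventually_mono)
qed (use assms in \<open>auto simp: admissible_def\<close>)

lemma worst_feasible: "worst q \<Longrightarrow> feasible p \<phi> F \<epsilon> q"
  unfolding worst_case_quantile_def is_arg_max_def by simp

lemma worst_gain_ge:
  assumes "worst q" "admissible g" "divg g \<le> \<epsilon>"
  shows "gain g \<le> gain q"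
proof -
  obtain g' where g': "feasible p \<phi> F \<epsilon> g'" "AE u in unif. g' u = g u"
    using admissible_feasible[OF assms(2,3)] .
  have "choquet_quantile h g' \<le> choquet_quantile h q"
    using assms(1) g'(1) unfolding worst_case_quantile_def is_arg_max_def by force
  then show ?thesis
    using feasible_admissible(3)[OF g'(1)] feasible_admissible(3)[OF worst_feasible[OF assms(1)]]
      gain_cong_AE[OF g'(2) feasible_admissible(1)[OF g'(1)] assms(2)] by simp
qed

lemma admissible_convex:
  assumes g: "admissible g" and k: "admissible k" and t: "0 \<le> t" "t \<le> 1"
  defines "m \<equiv> \<lambda>u. (1 - t) * g u + t * k u"
  shows "admissible m" "gain m = (1 - t) * gain g + t * gain k"
    "divg m \<le> (1 - t) * divg g + t * divg k"
proof -
  have mono: "mono_on {0<..<1} m"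
    unfolding m_def using g k t unfolding admissible_def mono_on_def
    by (intro allI impI add_mono mult_left_mono) auto
  have [measurable]: "m \<in> borel_measurable unif" by (rule mono_on_unif_measurable[OF mono])
  have [measurable]: "(\<lambda>u. \<bar>m u\<bar> powr p) \<in> borel_measurable unif" by measurable
  have P: "integrable unif (\<lambda>u. \<bar>m u\<bar> powr p)"
  proof (rule Bochner_Integration.integrable_bound)
    show "integrable unif (\<lambda>u. \<bar>g u\<bar> powr p + \<bar>k u\<bar> powr p)"
      using g k unfolding admissible_def by auto
    show "AE u in unif. norm (\<bar>m u\<bar> powr p) \<le> norm (\<bar>g u\<bar> powr p + \<bar>k u\<bar> powr p)"
      using abs_powr_convex_combination[OF t p] by (auto simp: m_def)
  qed measurable
  have le: "bregman \<phi> (m u) (f u) \<le> (1 - t) * bregman \<phi> (g u) (f u) + t * bregman \<phi> (k u) (f u)" for u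
    unfolding m_def by (rule bregman_convex[OF t])
  have I: "integrable unif (\<lambda>u. (1 - t) * bregman \<phi> (g u) (f u) + t * bregman \<phi> (k u) (f u))"
    using g k unfolding admissible_def by auto
  have B: "integrable unif (\<lambda>u. bregman \<phi> (m u) (f u))"
  proof (rule Bochner_Integration.integrable_bound[OF I])
    show "AE u in unif. norm (bregman \<phi> (m u) (f u)) \<le>
        norm ((1 - t) * bregman \<phi> (g u) (f u) + t * bregman \<phi> (k u) (f u))"
      using le bregman_nonneg t by (auto simp: abs_of_nonneg)
  qed measurable
  have eq: "\<gamma> u * m u = (1 - t) * (\<gamma> u * g u) + t * (\<gamma> u * k u)" for u
    by (simp add: m_def algebra_simps)
  have "integrable unif (\<lambda>u. \<gamma> u * m u)"
    unfolding eq using g k unfolding admissible_def by auto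
  then show "admissible m" using mono P B unfolding admissible_def by auto
  show "gain m = (1 - t) * gain g + t * gain k"
    unfolding gain_def eq using g k unfolding admissible_def by simp
  have "divg m \<le> (\<integral>u. (1 - t) * bregman \<phi> (g u) (f u) + t * bregman \<phi> (k u) (f u) \<partial>unif)"
    unfolding divg_def by (rule integral_mono[OF B I le])
  also have "\<dots> = (1 - t) * divg g + t * divg k"
    unfolding divg_def using g k unfolding admissible_def by simp
  finally show "divg m \<le> (1 - t) * divg g + t * divg k" .
qed

section \<open>Multipliers by separation\<close>

text \<open>Multipliers of Fritz John type: the objective has a multiplier \<open>a\<close> of its
  own, which may vanish at this stage.\<close>

definition multipliers :: "(real \<Rightarrow> real) \<Rightarrow> real \<Rightarrow> real \<Rightarrow> bool" where
  "multipliers q a b \<longleftrightarrow> 0 \<le> a \<and> 0 \<le> b \<and> (a \<noteq> 0 \<or> b \<noteq> 0) \<and>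
     (\<forall>g. admissible g \<longrightarrow> a * gain g - b * divg g \<le> a * gain q - b * divg q)"

lemma multipliers_exist:
  assumes q: "worst q"
  obtains a b where "multipliers q a b" "b * (\<epsilon> - divg q) = 0"
proof -
  note adq = feasible_admissible[OF worst_feasible[OF q]]
  \<comment> \<open>Values worse than attained ones are included in \<open>A\<close>; this makes
    \<open>A\<close> convex although the divergence is convex rather than affine. \<open>T\<close>
    consists of the better values respecting the constraint.\<close>
  define A where "A = {(x, y). \<exists>g. admissible g \<and> x \<le> gain g \<and> divg g \<le> y}"
  define T where "T = {(x, y). gain q < x \<and> y \<le> \<epsilon>}"
  have "convex A"
  proof (rule convexI)
    fix z w :: "real \<times> real" and s t :: real
    assume z: "z \<in> A" and w: "w \<in> A" and st: "0 \<le> s" "0 \<le> t" "s + t = 1"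
    obtain g where g: "admissible g" "fst z \<le> gain g" "divg g \<le> snd z"
      using z unfolding A_def by auto
    obtain k where k: "admissible k" "fst w \<le> gain k" "divg k \<le> snd w"
      using w unfolding A_def by auto
    have s: "s = 1 - t" "t \<le> 1" using st by auto
    note c = admissible_convex[OF g(1) k(1) st(2) s(2)]
    have "s * fst z + t * fst w \<le> s * gain g + t * gain k"
      using g k st by (intro add_mono mult_left_mono) auto
    moreover have "s * divg g + t * divg k \<le> s * snd z + t * snd w"
      using g k st by (intro add_mono mult_left_mono) auto
    ultimately have "admissible (\<lambda>u. (1 - t) * g u + t * k u) \<and>
        s * fst z + t * fst w \<le> gain (\<lambda>u. (1 - t) * g u + t * k u) \<and>
        divg (\<lambda>u. (1 - t) * g u + t * k u) \<le> s * snd z + t * snd w"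
      using c s by auto
    then show "s *\<^sub>R z + t *\<^sub>R w \<in> A"
      unfolding A_def by (cases z; cases w) auto
  qed
  moreover have "convex T"
  proof (rule convexI)
    fix z w :: "real \<times> real" and s t :: real
    assume z: "z \<in> T" and w: "w \<in> T" and st: "0 \<le> s" "0 \<le> t" "s + t = 1"
    have "s * (- fst z) + t * (- fst w) < - gain q"
      using z w st unfolding T_def by (intro convex_bound_lt) auto
    then have "gain q < s * fst z + t * fst w" by simp
    moreover have "s * snd z + t * snd w \<le> \<epsilon>"
      using z w st unfolding T_def by (auto intro!: convex_bound_le)
    ultimately show "s *\<^sub>R z + t *\<^sub>R w \<in> T"
      unfolding T_def by (cases z; cases w) auto
  qed
  moreover have "A \<noteq> {}" using adq(1) unfolding A_def by auto
  moreover have "T \<noteq> {}" using lt_ex gt_ex[of "gain q"] unfolding T_def by fastforce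
  moreover have "A \<inter> T = {}"
    using worst_gain_ge[OF q] unfolding A_def T_def by fastforce
  ultimately obtain n \<beta> where n: "n \<noteq> 0" "\<forall>x\<in>A. inner n x \<le> \<beta>" "\<forall>x\<in>T. inner n x \<ge> \<beta>"
    using separating_hyperplane_sets[of A T] by auto
  \<comment> \<open>The sign of the second component is flipped so that the separating functional is
    a Lagrangian.\<close>
  define a b where "a = fst n" and "b = - snd n"
  have inner: "inner n (x, y) = a * x - b * y" for x y
    unfolding a_def b_def by (cases n) simp
  have A: "a * gain g - b * divg g \<le> \<beta>" if "admissible g" for g
    using n(2) that inner unfolding A_def by auto
  have T: "\<beta> \<le> a * (gain q + s) - b * (\<epsilon> - t)" if "0 < s" "0 \<le> t" for s t
    using n(3) that inner unfolding T_def by auto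
  \<comment> \<open>\<open>T\<close> excludes the line through \<open>gain q\<close>; it is reached
    as \<open>s\<close> tends to 0 from the right.\<close>
  have lim: "\<beta> \<le> a * gain q - b * (\<epsilon> - t)" if "0 \<le> t" for t
  proof (rule tendsto_lowerbound)
    show "((\<lambda>s. a * (gain q + s) - b * (\<epsilon> - t)) \<longlongrightarrow> a * gain q - b * (\<epsilon> - t)) (at_right 0)"
      by (auto intro!: tendsto_eq_intros)
    show "\<forall>\<^sub>F s in at_right 0. \<beta> \<le> a * (gain q + s) - b * (\<epsilon> - t)"
      using T that by (auto simp: eventually_at_right_field intro!: exI[of _ 1])
  qed simp
  have a: "0 \<le> a"
  proof (rule ccontr)
    assume neg: "\<not> 0 \<le> a"
    \<comment> \<open>\<open>T\<close> is unbounded towards larger gains. If \<open>a\<close> were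
      negative, this \<open>s\<close> would push the functional on \<open>T\<close> at least 1 below
      \<open>\<beta>\<close>. The same is done for \<open>b\<close> with decreasing
      divergences.\<close>
    define s where "s = max 1 ((a * gain q - b * \<epsilon> - \<beta> + 1) / (- a))"
    have "(a * gain q - b * \<epsilon> - \<beta> + 1) / (- a) \<le> s" "0 < s" by (auto simp: s_def)
    then show False
      using T[of s 0] neg by (simp add: pos_divide_le_eq field_simps)
  qed
  have b: "0 \<le> b"
  proof (rule ccontr)
    assume neg: "\<not> 0 \<le> b"
    define s where "s = max 1 ((a * gain q - b * \<epsilon> - \<beta> + 1) / (- b))"
    have "(a * gain q - b * \<epsilon> - \<beta> + 1) / (- b) \<le> s" "0 < s" by (auto simp: s_def)
    then show False
      using lim[of s] neg by (simp add: pos_divide_le_eq field_simps)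
  qed
  have le: "a * gain g - b * divg g \<le> a * gain q - b * \<epsilon>" if "admissible g" for g
    using A[OF that] lim[of 0] by simp
  \<comment> \<open>Complementary slackness, by testing with the optimiser itself.\<close>
  have "b * (\<epsilon> - divg q) \<le> 0" using le[OF adq(1)] by (simp add: algebra_simps)
  moreover have "0 \<le> b * (\<epsilon> - divg q)" using b adq(2) by simp
  ultimately have bind: "b * (\<epsilon> - divg q) = 0" by simp
  moreover have "a \<noteq> 0 \<or> b \<noteq> 0" using n(1) unfolding a_def b_def by (auto simp: prod_eq_iff)
  moreover have "a * gain g - b * divg g \<le> a * gain q - b * divg q" if "admissible g" for g
    using le[OF that] bind unfolding right_diff_distrib by linarith
  ultimately show ?thesis using that a b unfolding multipliers_def by blast
qed

section \<open>One-sided perturbations of an optimiser\<close>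

text \<open>The change of the Lagrangian is at most 0 by optimality and, by
  \<open>bregman_diff_le\<close>, at least the first-order term with the derivative at the perturbed
  point. \<open>N\<close> keeps the perturbed divergence finite. Any integrable minorant
  \<open>e\<close> of the first-order term may be used, so integrability of that term itself never
  has to be shown.\<close>

lemma perturbation:
  assumes M: "multipliers q a b" and q: "admissible q"
    and mono: "mono_on {0<..<1} (\<lambda>u. q u + w u)"
    and w: "\<And>u. u \<in> {0<..<1} \<Longrightarrow> \<bar>w u\<bar> \<le> 1"
    and N: "integrable unif N"
      "\<And>u. u \<in> {0<..<1} \<Longrightarrow> (d (q u + w u) - \<Phi> u) * w u \<le> N u"
    and e: "integrable unif e"
      "AE u in unif. e u \<le> (a * \<gamma> u + b * (\<Phi> u - d (q u + w u))) * w u"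
  shows "(\<integral>u. e u \<partial>unif) \<le> 0"
proof -
  let ?g = "\<lambda>u. q u + w u"
  have [measurable]: "?g \<in> borel_measurable unif" by (rule mono_on_unif_measurable[OF mono])
  have [measurable]: "q \<in> borel_measurable unif"
    using q unfolding admissible_def by (intro mono_on_unif_measurable) simp
  have "(\<lambda>u. ?g u - q u) \<in> borel_measurable unif" by measurable
  then have [measurable]: "w \<in> borel_measurable unif" by simp
  have [measurable]: "(\<lambda>u. \<bar>?g u\<bar> powr p) \<in> borel_measurable unif" by measurable
  have P: "integrable unif (\<lambda>u. \<bar>?g u\<bar> powr p)"
  proof (rule Bochner_Integration.integrable_bound)
    show "integrable unif (\<lambda>u. 2 powr p * (\<bar>q u\<bar> powr p + 1))"
      using q unfolding admissible_def by auto
    have "\<bar>?g u\<bar> powr p \<le> 2 powr p * (\<bar>q u\<bar> powr p + 1)" if "u \<in> {0<..<1}" for u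
      by (rule abs_powr_add_le[OF w[OF that] p])
    then show "AE u in unif. norm (\<bar>?g u\<bar> powr p) \<le> norm (2 powr p * (\<bar>q u\<bar> powr p + 1))"
      by (intro AE_I2) (auto simp: abs_of_nonneg)
  qed measurable
  have Gw: "integrable unif (\<lambda>u. \<gamma> u * w u)"
  proof (rule Bochner_Integration.integrable_bound[OF gamma_integrable])
    show "AE u in unif. norm (\<gamma> u * w u) \<le> norm (\<gamma> u)"
      using w by (intro AE_I2) (auto simp: abs_mult mult_left_le)
  qed measurable
  have Gq: "integrable unif (\<lambda>u. \<gamma> u * q u)" and Bq: "integrable unif (\<lambda>u. bregman \<phi> (q u) (f u))"
    using q unfolding admissible_def by auto
  have G: "integrable unif (\<lambda>u. \<gamma> u * ?g u)"
    using Gw Gq by (simp add: distrib_left)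
  \<comment> \<open>The divergence integrand is non-negative, so a bound from above
    suffices.\<close>
  have B: "integrable unif (\<lambda>u. bregman \<phi> (?g u) (f u))"
  proof (rule Bochner_Integration.integrable_bound)
    show "integrable unif (\<lambda>u. bregman \<phi> (q u) (f u) + N u)"
      using N(1) Bq by auto
    have "bregman \<phi> (?g u) (f u) \<le> bregman \<phi> (q u) (f u) + N u" if "u \<in> {0<..<1}" for u
      using bregman_diff_le[of "?g u" "f u" "q u"] N(2)[OF that] by simp
    then show "AE u in unif. norm (bregman \<phi> (?g u) (f u)) \<le> norm (bregman \<phi> (q u) (f u) + N u)"
      using bregman_nonneg by (intro AE_I2) (fastforce simp: abs_of_nonneg)
  qed measurable
  have ad: "admissible ?g" using mono P G B unfolding admissible_def by auto
  let ?D = "\<lambda>u. a * (\<gamma> u * w u) - b * (bregman \<phi> (?g u) (f u) - bregman \<phi> (q u) (f u))"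
  have "(\<integral>u. ?D u \<partial>unif) = a * (gain ?g - gain q) - b * (divg ?g - divg q)"
    unfolding gain_def divg_def using G Gq Gw B Bq by (simp add: distrib_left)
  also have "\<dots> \<le> 0"
    using M ad unfolding multipliers_def by (fastforce simp: algebra_simps)
  finally have D: "(\<integral>u. ?D u \<partial>unif) \<le> 0" .
  have "(a * \<gamma> u + b * (\<Phi> u - d (?g u))) * w u \<le> ?D u" for u
  proof -
    have "b * (bregman \<phi> (?g u) (f u) - bregman \<phi> (q u) (f u)) \<le> b * ((d (?g u) - \<Phi> u) * w u)"
      using bregman_diff_le[of "?g u" "f u" "q u"] M unfolding multipliers_def
      by (intro mult_left_mono) auto
    then show ?thesis by (simp add: algebra_simps)
  qed
  then have "AE u in unif. e u \<le> ?D u"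
    using e(2) by (auto elim!: eventually_mono intro: order_trans)
  then have "(\<integral>u. e u \<partial>unif) \<le> (\<integral>u. ?D u \<partial>unif)"
    using Gw B Bq e(1) by (intro integral_mono_AE) auto
  then show ?thesis using D by simp
qed

text \<open>Wherever \<open>q\<close> is actually raised, the new value is at most \<open>c\<close>.
  The derivative there may thus be replaced by the constant \<open>d c\<close>, and finiteness of
  the divergence needs only a lower bound on \<open>\<Phi>\<close> over \<open>A\<close>.\<close>

lemma raise_variation:
  fixes A c
  defines "w \<equiv> \<lambda>u q. if u \<in> A then min (max 0 (c - q)) 1 else (0 :: real)"
  assumes M: "multipliers q a b" and q: "admissible q"
    and up: "\<And>u v. u \<in> A \<Longrightarrow> u \<le> v \<Longrightarrow> v < 1 \<Longrightarrow> v \<in> A"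
    and N: "integrable unif N" "\<And>u. u \<in> {0<..<1} \<Longrightarrow> 0 \<le> N u"
      "\<And>u. u \<in> {0<..<1} \<Longrightarrow> u \<in> A \<Longrightarrow> d c - \<Phi> u \<le> N u"
    and e: "integrable unif e"
      "AE u in unif. e u \<le> (a * \<gamma> u + b * (\<Phi> u - d c)) * w u (q u)"
  shows "(\<integral>u. e u \<partial>unif) \<le> 0"
proof (rule perturbation[OF M q _ _ N(1) _ e(1)])
  have monoq: "mono_on {0<..<1} q" using q unfolding admissible_def by simp
  show "mono_on {0<..<1} (\<lambda>u. q u + w u (q u))"
  proof (rule mono_onI)
    fix u v :: real assume uv: "u \<in> {0<..<1}" "v \<in> {0<..<1}" "u \<le> v"
    then have "q u \<le> q v" by (rule mono_onD[OF monoq])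
    \<comment> \<open>On \<open>A\<close> the new value is \<open>max q (min c (q + 1))\<close>,
      which is increasing in \<open>q\<close>; since \<open>A\<close> is closed upwards, no unraised
      point follows a raised one.\<close>
    then show "q u + w u (q u) \<le> q v + w v (q v)"
      using up[of u v] uv by (auto simp: w_def min_def max_def)
  qed
  show "\<bar>w u (q u)\<bar> \<le> 1" for u by (auto simp: w_def)
  have w0: "0 \<le> w u x" "w u x \<le> 1" for u x by (auto simp: w_def)
  have dc: "d (q u + w u (q u)) * w u (q u) \<le> d c * w u (q u)" for u
  proof (cases "w u (q u) = 0")
    case False
    then have "q u + w u (q u) \<le> c" by (auto simp: w_def split: if_splits)
    then show ?thesis using w0 by (intro mult_right_mono) auto
  qed simp
  show "(d (q u + w u (q u)) - \<Phi> u) * w u (q u) \<le> N u" if u: "u \<in> {0<..<1}" for u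
  proof (cases "u \<in> A")
    case True
    have "(d (q u + w u (q u)) - \<Phi> u) * w u (q u) \<le> (d c - \<Phi> u) * w u (q u)"
      using dc[of u] by (simp add: algebra_simps)
    also have "\<dots> \<le> N u * w u (q u)" using N(3)[OF u True] w0 by (intro mult_right_mono) auto
    also have "\<dots> \<le> N u" using N(2)[OF u] w0 by (intro mult_left_le) auto
    finally show ?thesis .
  next
    case False then show ?thesis using N(2)[OF u] by (simp add: w_def)
  qed
  have "(a * \<gamma> u + b * (\<Phi> u - d c)) * w u (q u)
      \<le> (a * \<gamma> u + b * (\<Phi> u - d (q u + w u (q u)))) * w u (q u)" for u
    using mult_left_mono[OF dc[of u], of b] M unfolding multipliers_def by (simp add: algebra_simps)
  then show "AE u in unif. e u \<le> (a * \<gamma> u + b * (\<Phi> u - d (q u + w u (q u)))) * w u (q u)"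
    using e(2) by (auto elim!: eventually_mono intro: order_trans)
qed

text \<open>The mirror image of \<open>raise_variation\<close>: the new value is at least
  \<open>c\<close> where \<open>q\<close> is lowered, and an upper bound on \<open>\<Phi>\<close>
  over a downward closed set replaces the lower one.\<close>

lemma lower_variation:
  fixes A c
  defines "w \<equiv> \<lambda>u q. if u \<in> A then min (max 0 (q - c)) 1 else (0 :: real)"
  assumes M: "multipliers q a b" and q: "admissible q"
    and down: "\<And>u v. v \<in> A \<Longrightarrow> u \<le> v \<Longrightarrow> 0 < u \<Longrightarrow> u \<in> A"
    and N: "integrable unif N" "\<And>u. u \<in> {0<..<1} \<Longrightarrow> 0 \<le> N u"
      "\<And>u. u \<in> {0<..<1} \<Longrightarrow> u \<in> A \<Longrightarrow> \<Phi> u - d c \<le> N u"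
    and e: "integrable unif e"
      "AE u in unif. e u \<le> - (a * \<gamma> u + b * (\<Phi> u - d c)) * w u (q u)"
  shows "(\<integral>u. e u \<partial>unif) \<le> 0"
proof (rule perturbation[OF M q _ _ N(1) _ e(1)])
  let ?w = "\<lambda>u. - w u (q u)"
  have monoq: "mono_on {0<..<1} q" using q unfolding admissible_def by simp
  show "mono_on {0<..<1} (\<lambda>u. q u + ?w u)"
  proof (rule mono_onI)
    fix u v :: real assume uv: "u \<in> {0<..<1}" "v \<in> {0<..<1}" "u \<le> v"
    then have "q u \<le> q v" by (rule mono_onD[OF monoq])
    then show "q u + ?w u \<le> q v + ?w v"
      using down[of v u] uv by (auto simp: w_def min_def max_def)
  qed
  show "\<bar>?w u\<bar> \<le> 1" for u by (auto simp: w_def)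
  have w0: "0 \<le> w u x" "w u x \<le> 1" for u x by (auto simp: w_def)
  have dc: "d c * w u (q u) \<le> d (q u + ?w u) * w u (q u)" for u
  proof (cases "w u (q u) = 0")
    case False
    then have "c \<le> q u + ?w u" by (auto simp: w_def split: if_splits)
    then show ?thesis using w0 by (intro mult_right_mono) auto
  qed simp
  show "(d (q u + ?w u) - \<Phi> u) * ?w u \<le> N u" if u: "u \<in> {0<..<1}" for u
  proof (cases "u \<in> A")
    case True
    have "(d (q u + ?w u) - \<Phi> u) * ?w u \<le> (\<Phi> u - d c) * w u (q u)"
      using dc[of u] by (simp add: algebra_simps)
    also have "\<dots> \<le> N u * w u (q u)" using N(3)[OF u True] w0 by (intro mult_right_mono) auto
    also have "\<dots> \<le> N u" using N(2)[OF u] w0 by (intro mult_left_le) auto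
    finally show ?thesis .
  next
    case False then show ?thesis using N(2)[OF u] by (simp add: w_def)
  qed
  have "- (a * \<gamma> u + b * (\<Phi> u - d c)) * w u (q u)
      \<le> (a * \<gamma> u + b * (\<Phi> u - d (q u + ?w u))) * ?w u" for u
    using mult_left_mono[OF dc[of u], of b] M unfolding multipliers_def by (simp add: algebra_simps)
  then show "AE u in unif. e u \<le> (a * \<gamma> u + b * (\<Phi> u - d (q u + ?w u))) * ?w u"
    using e(2) by (auto elim!: eventually_mono intro: order_trans)
qed

lemma admissible_measurable: "admissible g \<Longrightarrow> g \<in> borel_measurable unif"
  unfolding admissible_def by (auto intro: mono_on_unif_measurable)

text \<open>Raising \<open>q\<close> towards \<open>c\<close> beyond \<open>u0\<close> would improve
  the Lagrangian at rate at least \<open>\<delta>\<close>, so the amount raised is zero almost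
  everywhere. Some point between \<open>u0\<close> and \<open>v\<close> then has value at least
  \<open>c\<close>, and monotonicity carries this to \<open>v\<close>.\<close>

lemma raise_above:
  assumes M: "multipliers q a b" and q: "admissible q" and u0: "u0 \<in> {0<..<1}" and v: "u0 < v" "v < 1"
    and "\<delta> > 0" and e: "\<And>u. u0 < u \<Longrightarrow> u < 1 \<Longrightarrow> \<delta> \<le> a * \<gamma> u + b * (\<Phi> u - d c)"
  shows "c \<le> q v"
proof (rule ccontr)
  assume less: "\<not> c \<le> q v"
  define A where "A = {u0<..<1}"
  have [measurable]: "A \<in> sets unif" using u0 by (auto simp: A_def sets_restrict_space_iff)
  have [measurable]: "q \<in> borel_measurable unif" by (rule admissible_measurable[OF q])
  let ?w = "\<lambda>u. if u \<in> A then min (max 0 (c - q u)) 1 else 0"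
  have I: "integrable unif (\<lambda>u. \<delta> * ?w u)"
  proof (rule unif.integrable_const_bound[where B = \<delta>])
    show "AE u in unif. norm (\<delta> * ?w u) \<le> \<delta>"
      using \<open>\<delta> > 0\<close> by (intro AE_I2) (simp add: abs_mult mult_left_le)
    have "(\<lambda>u. indicator A u * min (max 0 (c - q u)) 1) \<in> borel_measurable unif"
      by measurable
    moreover have "indicator A u * min (max 0 (c - q u)) 1 = ?w u" for u
      by (simp add: indicator_def)
    ultimately show "(\<lambda>u. \<delta> * ?w u) \<in> borel_measurable unif" by simp
  qed
  have "(\<integral>u. \<delta> * ?w u \<partial>unif) \<le> 0"
  proof (rule raise_variation[OF M q])
    show "u \<in> A \<Longrightarrow> u \<le> v \<Longrightarrow> v < 1 \<Longrightarrow> v \<in> A" for u v by (auto simp: A_def)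
    \<comment> \<open>Beyond \<open>u0\<close> the function \<open>\<Phi>\<close> is bounded below
      by its value at \<open>u0\<close>, so a constant majorant works even if \<open>\<Phi>\<close>
      is not integrable.\<close>
    show "integrable unif (\<lambda>u. max 0 (d c - \<Phi> u0))" by simp
    show "d c - \<Phi> u \<le> max 0 (d c - \<Phi> u0)" if "u \<in> {0<..<1}" "u \<in> A" for u
      using \<Phi>_mono[of u0 u] u0 that by (auto simp: A_def simp del: d_le_iff)
    have "\<delta> \<le> a * \<gamma> u + b * (\<Phi> u - d c)" if "u \<in> A" for u
      using e[of u] that by (auto simp: A_def)
    then show "AE u in unif. \<delta> * ?w u \<le> (a * \<gamma> u + b * (\<Phi> u - d c)) * ?w u"
      by (intro AE_I2) (auto intro: mult_right_mono)
  qed (use I in auto)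
  then have "AE u in unif. \<delta> * ?w u = 0"
    using \<open>\<delta> > 0\<close> by (intro integral_nonpos_imp_AE_0 I) auto
  then obtain u where u: "u0 < u" "u < v" "\<delta> * ?w u = 0"
    using v u0 by (elim AE_unif_interval[of _ u0 v]) auto
  have "q u \<le> q v" using q u v u0 unfolding admissible_def by (auto intro!: mono_onD[of "{0<..<1}" q])
  then show False using u v less \<open>\<delta> > 0\<close> by (auto simp: A_def min_def max_def split: if_splits)
qed

text \<open>The mirror image of \<open>raise_above\<close>, by lowering \<open>q\<close> on the
  interval below \<open>u0\<close>.\<close>

lemma lower_below:
  assumes M: "multipliers q a b" and q: "admissible q" and u0: "u0 \<in> {0<..<1}" and v: "0 < v" "v < u0"
    and "\<delta> > 0" and e: "\<And>u. 0 < u \<Longrightarrow> u < u0 \<Longrightarrow> a * \<gamma> u + b * (\<Phi> u - d c) \<le> - \<delta>"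
  shows "q v \<le> c"
proof (rule ccontr)
  assume less: "\<not> q v \<le> c"
  define A where "A = {0<..<u0}"
  have [measurable]: "A \<in> sets unif" using u0 by (auto simp: A_def sets_restrict_space_iff)
  have [measurable]: "q \<in> borel_measurable unif" by (rule admissible_measurable[OF q])
  let ?w = "\<lambda>u. if u \<in> A then min (max 0 (q u - c)) 1 else 0"
  have I: "integrable unif (\<lambda>u. \<delta> * ?w u)"
  proof (rule unif.integrable_const_bound[where B = \<delta>])
    show "AE u in unif. norm (\<delta> * ?w u) \<le> \<delta>"
      using \<open>\<delta> > 0\<close> by (intro AE_I2) (simp add: abs_mult mult_left_le)
    have "(\<lambda>u. indicator A u * min (max 0 (q u - c)) 1) \<in> borel_measurable unif"
      by measurable
    moreover have "indicator A u * min (max 0 (q u - c)) 1 = ?w u" for u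
      by (simp add: indicator_def)
    ultimately show "(\<lambda>u. \<delta> * ?w u) \<in> borel_measurable unif" by simp
  qed
  have "(\<integral>u. \<delta> * ?w u \<partial>unif) \<le> 0"
  proof (rule lower_variation[OF M q])
    show "v \<in> A \<Longrightarrow> u \<le> v \<Longrightarrow> 0 < u \<Longrightarrow> u \<in> A" for u v by (auto simp: A_def)
    show "integrable unif (\<lambda>u. max 0 (\<Phi> u0 - d c))" by simp
    show "\<Phi> u - d c \<le> max 0 (\<Phi> u0 - d c)" if "u \<in> {0<..<1}" "u \<in> A" for u
      using \<Phi>_mono[of u u0] u0 that by (auto simp: A_def simp del: d_le_iff)
    have "\<delta> \<le> - (a * \<gamma> u + b * (\<Phi> u - d c))" if "u \<in> A" for u
      using e[of u] that by (auto simp: A_def)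
    then show "AE u in unif. \<delta> * ?w u \<le> - (a * \<gamma> u + b * (\<Phi> u - d c)) * ?w u"
      by (intro AE_I2) (auto intro: mult_right_mono)
  qed (use I in auto)
  then have "AE u in unif. \<delta> * ?w u = 0"
    using \<open>\<delta> > 0\<close> by (intro integral_nonpos_imp_AE_0 I) auto
  then obtain u where u: "v < u" "u < u0" "\<delta> * ?w u = 0"
    using v u0 by (elim AE_unif_interval[of _ v u0]) auto
  have "q v \<le> q u" using q u v u0 unfolding admissible_def by (auto intro!: mono_onD[of "{0<..<1}" q])
  then show False using u v less \<open>\<delta> > 0\<close> by (auto simp: A_def min_def max_def split: if_splits)
qed

section \<open>Stationarity and positivity of the multipliers\<close>

text \<open>Raising and lowering compare \<open>a * \<gamma> + b * \<Phi>\<close> at one point with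
  \<open>b * d (q v)\<close> at a different point \<open>v\<close>. Almost every point is a point of
  left continuity of both functions, and there left limits join the two comparisons into an
  equality.\<close>

lemma first_order_mono:
  assumes M: "multipliers q a b" "0 < b" and q: "admissible q"
    and mono: "mono_on {0<..<1} (\<lambda>u. a * \<gamma> u + b * \<Phi> u)"
  shows "AE u in unif. b * d (q u) = a * \<gamma> u + b * \<Phi> u"
proof -
  let ?K = "\<lambda>u. a * \<gamma> u + b * \<Phi> u"
  have mono_q: "mono_on {0<..<1} q" using q unfolding admissible_def by simp
  have up: "?K u \<le> b * d (q v)" if "0 < u" "u < v" "v < 1" for u v
  proof (rule ccontr)
    assume "\<not> ?thesis"
    then have "d (q v) < ?K u / b" using M(2) by (simp add: field_simps)
    \<comment> \<open>A level strictly in between leaves the slack \<open>?K u - b * m\<close>,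
      which monotonicity of \<open>?K\<close> preserves on all of \<open>(u, 1)\<close>.\<close>
    then obtain m where m: "d (q v) < m" "m < ?K u / b" using dense by blast
    have "\<psi> m \<le> q v"
    proof (rule raise_above[OF M(1) q, of u])
      show "0 < ?K u - b * m" using m(2) M(2) by (simp add: field_simps)
      show "?K u - b * m \<le> a * \<gamma> w + b * (\<Phi> w - d (\<psi> m))" if "u < w" "w < 1" for w
        using mono_onD[OF mono, of u w] that \<open>0 < u\<close> by (simp add: algebra_simps)
    qed (use that in auto)
    then show False using m(1) d_le_iff[of "\<psi> m" "q v"] by simp
  qed
  have down: "b * d (q v) \<le> ?K u" if "0 < v" "v < u" "u < 1" for u v
  proof (rule ccontr)
    assume "\<not> ?thesis"
    then have "?K u / b < d (q v)" using M(2) by (simp add: field_simps)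
    then obtain m where m: "?K u / b < m" "m < d (q v)" using dense by blast
    have "q v \<le> \<psi> m"
    proof (rule lower_below[OF M(1) q, of u])
      show "0 < b * m - ?K u" using m(1) M(2) by (simp add: field_simps)
      show "a * \<gamma> w + b * (\<Phi> w - d (\<psi> m)) \<le> - (b * m - ?K u)" if "0 < w" "w < u" for w
        using mono_onD[OF mono, of w u] that \<open>u < 1\<close> by (simp add: algebra_simps)
    qed (use that in auto)
    then show False using m(2) d_le_iff[of "q v" "\<psi> m"] by simp
  qed
  have cont_d: "isCont d x" for x using continuous_d by (simp add: continuous_on_eq_continuous_at)
  show ?thesis
    using AE_continuous_at_left[OF mono] AE_continuous_at_left[OF mono_q] AE_space[of unif]
  proof eventually_elim
    case (elim u)
    then have u: "0 < u" "u < 1" by auto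
    have K: "(?K \<longlongrightarrow> ?K u) (at_left u)" using elim(1) by (simp add: continuous_within)
    have "((\<lambda>v. d (q v)) \<longlongrightarrow> d (q u)) (at_left u)"
      using isCont_tendsto_compose[OF cont_d] elim(2) by (simp add: continuous_within)
    then have Q: "((\<lambda>v. b * d (q v)) \<longlongrightarrow> b * d (q u)) (at_left u)" by (rule tendsto_mult_left)
    have ev: "\<forall>\<^sub>F v in at_left u. v \<in> {0<..<u}" by (rule eventually_at_left_real) (rule u)
    have "?K u \<le> b * d (q u)"
      by (rule tendsto_upperbound[OF K])
        (use up u in \<open>auto intro!: eventually_mono[OF ev] simp del: d_le_iff\<close>)
    moreover have "b * d (q u) \<le> ?K u"
      by (rule tendsto_upperbound[OF Q])
        (use down u in \<open>auto intro!: eventually_mono[OF ev]\<close>)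
    ultimately show ?case by simp
  qed
qed

text \<open>With \<open>b = 0\<close> the level \<open>c\<close> drops out of the first-order term.
  Where \<open>\<gamma>\<close> is positive it stays so to the right, and \<open>q\<close> would
  exceed every level there, in particular its own value plus 1. Negative values are excluded
  symmetrically to the left.\<close>

lemma multiplier_pos_mono:
  assumes M: "multipliers q a b" and q: "admissible q" and mono: "mono_on {0<..<1} \<gamma>"
  shows "0 < b"
proof (rule ccontr)
  assume "\<not> 0 < b"
  then have b: "b = 0" and a: "0 < a" using M unfolding multipliers_def by auto
  have "\<gamma> u = 0" if u: "u \<in> {0<..<1}" for u
  proof (rule ccontr)
    assume "\<gamma> u \<noteq> 0"
    then consider "0 < \<gamma> u" | "\<gamma> u < 0" by linarith
    then show False
    proof cases
      case 1
      have "q ((u + 1) / 2) + 1 \<le> q ((u + 1) / 2)"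
        by (rule raise_above[OF M q u, of _ "a * \<gamma> u"])
          (use 1 a b u mono_onD[OF mono, of u] in auto)
      then show False by simp
    next
      case 2
      have "q (u / 2) \<le> q (u / 2) - 1"
        by (rule lower_below[OF M q u, of _ "a * - \<gamma> u"])
          (use 2 a b u mono_onD[OF mono, of _ u] mult_pos_neg[of a "\<gamma> u"] in auto)
      then show False by simp
    qed
  qed
  then have "AE u in unif. \<gamma> u = 0" by (intro AE_I2) simp
  then show False using gamma_nontrivial by simp
qed

text \<open>With \<open>b = 0\<close>, raising \<open>q\<close> towards any \<open>n\<close> on the
  whole interval costs nothing, so \<open>\<gamma>\<close> vanishes almost everywhere on
  \<open>{q < n}\<close>. These sets exhaust the interval.\<close>

lemma multiplier_pos_nonneg:
  assumes M: "multipliers q a b" and q: "admissible q" and nn: "\<And>u. u \<in> {0<..<1} \<Longrightarrow> 0 \<le> \<gamma> u"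
    and s\<Phi>: "square_integrable \<Phi>"
  shows "0 < b"
proof (rule ccontr)
  assume "\<not> 0 < b"
  then have b: "b = 0" and a: "0 < a" using M unfolding multipliers_def by auto
  have [measurable]: "q \<in> borel_measurable unif" by (rule admissible_measurable[OF q])
  have "AE u in unif. \<gamma> u * min (max 0 (real n - q u)) 1 = 0" for n
  proof -
    have I: "integrable unif (\<lambda>u. \<gamma> u * min (max 0 (real n - q u)) 1)"
      by (rule integrable_mult_bounded[OF gamma_integrable]) auto
    have "(\<integral>u. a * (\<gamma> u * min (max 0 (real n - q u)) 1) \<partial>unif) \<le> 0"
    proof (rule raise_variation[OF M q, where A = "{0<..<1}" and c = "real n"])
      \<comment> \<open>\<open>\<Phi>\<close> may be unbounded below near 0, so its integrability
        replaces the constant majorant of \<open>raise_above\<close>.\<close>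
      show "integrable unif (\<lambda>u. \<bar>d (real n)\<bar> + \<bar>\<Phi> u\<bar>)"
        using square_integrable_integrable[OF s\<Phi>] by simp
      show "integrable unif (\<lambda>u. a * (\<gamma> u * min (max 0 (real n - q u)) 1))" using I by simp
    qed (use b in auto)
    then have "(\<integral>u. \<gamma> u * min (max 0 (real n - q u)) 1 \<partial>unif) \<le> 0"
      using a by (simp add: mult_le_0_iff)
    then show ?thesis using nn by (intro integral_nonpos_imp_AE_0 I) auto
  qed
  then have "AE u in unif. \<forall>n. \<gamma> u * min (max 0 (real n - q u)) 1 = 0"
    unfolding AE_all_countable by blast
  then have "AE u in unif. \<gamma> u = 0"
  proof eventually_elim
    case (elim u)
    obtain n where n: "q u < real n" using reals_Archimedean2 by blast
    then show ?case using elim[rule_format, of n] by (auto simp: min_def max_def split: if_splits)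
  qed
  then show False using gamma_nontrivial by simp
qed

lemma multipliers_pos:
  assumes q: "worst q"
    and cases: "mono_on {0<..<1} \<gamma> \<or> (\<forall>u\<in>{0<..<1}. 0 \<le> \<gamma> u) \<and> square_integrable \<Phi>"
  obtains a b where "multipliers q a b" "0 < a" "0 < b"
    and "divg q = \<epsilon>"
proof -
  have ad: "admissible q" by (rule feasible_admissible(1)[OF worst_feasible[OF q]])
  obtain a b where M: "multipliers q a b" and bind: "b * (\<epsilon> - divg q) = 0"
    using multipliers_exist[OF q] .
  have b: "0 < b"
    using cases multiplier_pos_mono[OF M ad] multiplier_pos_nonneg[OF M ad] by blast
  then have div: "divg q = \<epsilon>" using bind by simp
  have "a \<noteq> 0"
  proof
    assume a: "a = 0"
    \<comment> \<open>With \<open>a = 0\<close> the function required to be monotone is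
      \<open>b * \<Phi>\<close>, so \<open>first_order_mono\<close> applies in both cases.\<close>
    have "AE u in unif. b * d (q u) = a * \<gamma> u + b * \<Phi> u"
      using b a \<Phi>_mono by (intro first_order_mono[OF M b ad]) (auto simp: mono_on_def)
    then have "AE u in unif. bregman \<phi> (q u) (f u) = 0"
    proof eventually_elim
      case (elim u)
      then have "d (q u) = \<Phi> u" using a b by simp
      then have "q u = f u" by (metis \<psi>_d)
      then show ?case by simp
    qed
    then have "divg q = 0" unfolding divg_def by (rule integral_eq_zero_AE)
    then show False using div eps by simp
  qed
  then have "0 < a" using M unfolding multipliers_def by auto
  then show ?thesis using that M b div by blast
qed

section \<open>Uniqueness of the optimiser\<close>

text \<open>The midpoint of two optimisers has the same gain. Were its divergence below
  \<open>\<epsilon>\<close>, its quantile version would be an optimiser with slack constraint,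
  against \<open>multipliers_pos\<close>. So the divergence is affine along the segment, and strict
  convexity forces equality almost everywhere; left continuity then gives it everywhere.\<close>

lemma worst_unique:
  assumes q: "worst q" "worst q'"
    and cases: "mono_on {0<..<1} \<gamma> \<or> (\<forall>u\<in>{0<..<1}. 0 \<le> \<gamma> u) \<and> square_integrable \<Phi>"
    and u: "u \<in> {0<..<1}"
  shows "q' u = q u"
proof -
  note fq = worst_feasible[OF q(1)] and fq' = worst_feasible[OF q(2)]
  note ad = feasible_admissible(1)[OF fq] and ad' = feasible_admissible(1)[OF fq']
  have div: "divg q = \<epsilon>" "divg q' = \<epsilon>" using multipliers_pos[OF _ cases] q by metis+
  define m where "m = (\<lambda>u. (1 - 1/2) * q u + (1/2) * q' u)"
  have m: "admissible m" "gain m = (1 - 1/2) * gain q + (1/2) * gain q'"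
    unfolding m_def using admissible_convex[OF ad ad', of "1/2"] by auto
  have gains: "gain q = gain q'"
    using worst_gain_ge[OF q(1) ad'] worst_gain_ge[OF q(2) ad] div by simp
  have "\<epsilon> \<le> divg m"
  proof (rule ccontr)
    assume less: "\<not> \<epsilon> \<le> divg m"
    obtain g where g: "feasible p \<phi> F \<epsilon> g" "AE u in unif. g u = m u"
      using admissible_feasible[OF m(1)] less by auto
    note adg = feasible_admissible[OF g(1)]
    have "gain g = gain q" using gain_cong_AE[OF g(2) adg(1) m(1)] m(2) gains by simp
    then have "worst g"
      using q(1) g(1) adg(3) feasible_admissible(3)[OF fq]
      unfolding worst_case_quantile_def is_arg_max_def by simp
    then have "divg g = \<epsilon>" using multipliers_pos[OF _ cases] by metis
    then show False using divg_cong_AE[OF g(2) adg(1) m(1)] less by simp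
  qed
  let ?e = "\<lambda>u. (1/2) * bregman \<phi> (q u) (f u) + (1/2) * bregman \<phi> (q' u) (f u) - bregman \<phi> (m u) (f u)"
  have "(\<integral>u. ?e u \<partial>unif) = (1/2) * divg q + (1/2) * divg q' - divg m"
    using ad ad' m(1) unfolding divg_def admissible_def by simp
  also have "\<dots> \<le> 0" using \<open>\<epsilon> \<le> divg m\<close> div by simp
  finally have int: "(\<integral>u. ?e u \<partial>unif) \<le> 0" .
  have pos: "0 < ?e u" if "q u \<noteq> q' u" for u
    using bregman_midpoint_less[OF that, of "f u"] unfolding m_def by simp
  have zero: "?e u = 0" if "q u = q' u" for u
    using that by (simp add: m_def)
  have "AE u in unif. ?e u = 0"
  proof (rule integral_nonpos_imp_AE_0[OF _ _ int])
    show "integrable unif ?e" using ad ad' m(1) unfolding admissible_def by auto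
    show "0 \<le> ?e u" for u using pos[of u] zero[of u] by (cases "q u = q' u") auto
  qed
  then have AE: "AE u in unif. q' u = q u" using pos by (auto elim!: eventually_mono) (metis less_irrefl)
  have cont: "continuous (at_left u) k" if "feasible p \<phi> F \<epsilon> k" for k
    using that quantile_continuous_at_left[OF moment_cdfs_is_cdf u] unfolding feasible_def by auto
  show ?thesis by (rule continuous_at_left_eqI[OF cont[OF fq'] cont[OF fq] u AE])
qed

section \<open>Non-decreasing weights\<close>

lemma worst_case_mono:
  assumes q: "worst q" and mono: "mono_on {0<..<1} \<gamma>"
  shows "\<exists>lam>0. bw_div \<phi> (cand_mono \<phi> F \<gamma> lam) f = ennreal \<epsilon> \<and>
           (\<forall>\<mu>>0. bw_div \<phi> (cand_mono \<phi> F \<gamma> \<mu>) f = ennreal \<epsilon> \<longrightarrow> lam \<le> \<mu>) \<and>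
           (AE u in unif. q u = cand_mono \<phi> F \<gamma> lam u)"
proof -
  have ad: "admissible q" by (rule feasible_admissible(1)[OF worst_feasible[OF q]])
  obtain a b where M: "multipliers q a b" and ab: "0 < a" "0 < b" and div: "divg q = \<epsilon>"
    using multipliers_pos[OF q disjI1[OF mono]] .
  let ?c = "cand_mono \<phi> F \<gamma>"
  \<comment> \<open>Dividing the stationarity condition by \<open>b\<close> leaves
    \<open>a / b\<close> in front of \<open>\<gamma>\<close>.\<close>
  define lam where "lam = b / a"
  have lam: "0 < lam" using ab by (simp add: lam_def)
  have meas: "?c \<mu> \<in> borel_measurable unif" for \<mu>
    unfolding cand_mono_def tilted_def by measurable
  have "mono_on {0<..<1} (\<lambda>u. a * \<gamma> u + b * \<Phi> u)"
    using ab mono_onD[OF mono] \<Phi>_mono by (intro mono_onI add_mono mult_left_mono) auto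
  then have "AE u in unif. b * d (q u) = a * \<gamma> u + b * \<Phi> u"
    by (rule first_order_mono[OF M ab(2) ad])
  then have AE: "AE u in unif. q u = ?c lam u"
  proof eventually_elim
    case (elim u)
    then have "d (q u) = tilted \<phi> F \<gamma> lam u"
      using ab by (simp add: tilted_def lam_def field_simps)
    then show ?case unfolding cand_mono_def by (metis \<psi>_d)
  qed
  have "bw_div \<phi> (?c lam) f = bw_div \<phi> q f"
    unfolding bw_div_def using AE by (intro nn_integral_cong_AE) (auto elim: eventually_mono)
  also have "\<dots> = ennreal \<epsilon>" using bw_div_eq_divg[of q] ad div unfolding admissible_def by simp
  finally have lam_div: "bw_div \<phi> (?c lam) f = ennreal \<epsilon>" .
  have least: "lam \<le> \<mu>" if \<mu>: "0 < \<mu>" "bw_div \<phi> (?c \<mu>) f = ennreal \<epsilon>" for \<mu>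
  proof (rule ccontr)
    assume "\<not> lam \<le> \<mu>"
    then have inv: "1 / lam < 1 / \<mu>" using \<mu>(1) by (simp add: frac_less2)
    \<comment> \<open>The smaller multiplier \<open>\<mu>\<close> moves the candidate strictly
      further from \<open>f\<close>, upwards or downwards according to the sign of
      \<open>\<gamma> u\<close>.\<close>
    have less: "bregman \<phi> (?c lam u) (f u) < bregman \<phi> (?c \<mu> u) (f u)" if "\<gamma> u \<noteq> 0" for u
    proof (cases "0 < \<gamma> u")
      case True
      have "\<psi> (\<Phi> u) \<le> ?c lam u"
        using True lam unfolding cand_mono_def tilted_def \<psi>_le_iff by simp
      moreover have "?c lam u < ?c \<mu> u"
        using mult_strict_right_mono[OF inv True] unfolding cand_mono_def tilted_def \<psi>_less_iff by simp
      ultimately show ?thesis by (intro bregman_mono_right) simp_all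
    next
      case False
      then have neg: "\<gamma> u < 0" using that by simp
      have "1 / lam * \<gamma> u \<le> 0" using neg lam by (intro mult_nonneg_nonpos) auto
      then have "?c lam u \<le> \<psi> (\<Phi> u)" unfolding cand_mono_def tilted_def \<psi>_le_iff by simp
      moreover have "?c \<mu> u < ?c lam u"
        using mult_strict_right_mono_neg[OF inv neg] unfolding cand_mono_def tilted_def \<psi>_less_iff by simp
      ultimately show ?thesis by (intro bregman_mono_left) simp_all
    qed
    have zero: "?c lam u = ?c \<mu> u" if "\<gamma> u = 0" for u
      using that by (simp add: cand_mono_def tilted_def)
    have I: "integrable unif (\<lambda>u. bregman \<phi> (?c \<nu> u) (f u))" "divg (?c \<nu>) = \<epsilon>"
      if "bw_div \<phi> (?c \<nu>) f = ennreal \<epsilon>" for \<nu>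
    proof -
      show I: "integrable unif (\<lambda>u. bregman \<phi> (?c \<nu> u) (f u))"
        using that by (intro integrable_bregmanI meas) simp
      show "divg (?c \<nu>) = \<epsilon>" using bw_div_eq_divg[OF I] that divg_nonneg eps by simp
    qed
    have "AE u in unif. bregman \<phi> (?c \<mu> u) (f u) - bregman \<phi> (?c lam u) (f u) = 0"
    proof (rule integral_nonpos_imp_AE_0)
      show "integrable unif (\<lambda>u. bregman \<phi> (?c \<mu> u) (f u) - bregman \<phi> (?c lam u) (f u))"
        using I[OF \<mu>(2)] I[OF lam_div] by simp
      show "0 \<le> bregman \<phi> (?c \<mu> u) (f u) - bregman \<phi> (?c lam u) (f u)" for u
        using less[of u] zero[of u] by (cases "\<gamma> u = 0") auto
      show "(\<integral>u. bregman \<phi> (?c \<mu> u) (f u) - bregman \<phi> (?c lam u) (f u) \<partial>unif) \<le> 0"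
        using I[OF \<mu>(2)] I[OF lam_div] unfolding divg_def by simp
    qed
    \<comment> \<open>Both divergences equal \<open>\<epsilon>\<close>, so the pointwise strict
      inequality can hold on a null set only.\<close>
    then have "AE u in unif. \<gamma> u = 0" by (auto elim!: eventually_mono) (metis less less_irrefl)
    then show False using gamma_nontrivial by simp
  qed
  show ?thesis using lam lam_div least AE by blast
qed

section \<open>Non-negative weights and the projection\<close>

text \<open>\<open>\<Phi>\<close> is itself in the cone. By \<open>isotonic_min_mono\<close> it is
  then a lower bound for the projection of a tilted function with non-negative weight.\<close>

lemma isotonic_min_deriv_quantile:
  assumes "square_integrable \<Phi>"
  shows "isotonic_min \<Phi> \<Phi>"
proof -
  have cont_d: "isCont d x" for x using continuous_d by (simp add: continuous_on_eq_continuous_at)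
  have "continuous (at_left u) \<Phi>" if "u \<in> {0<..<1}" for u
    using isCont_tendsto_compose[OF cont_d] quantile_continuous_at_left[OF F that]
    by (simp add: continuous_within)
  then have "\<Phi> \<in> isotonic_cone"
    using assms \<Phi>_mono by (intro isotonic_coneI mono_onI) auto
  moreover have "square_dist \<Phi> \<Phi> = 0" by (simp add: square_dist_def)
  ultimately show ?thesis using square_dist_nonneg unfolding isotonic_min_def by simp
qed

text \<open>By contradiction at \<open>u\<close>. If \<open>d (q u) < k u\<close>, take levels
  \<open>m1 < m2\<close> in between and raise \<open>q\<close> towards \<open>\<psi> m1\<close> on
  \<open>{k > m2}\<close>. Optimality of \<open>q\<close> makes the weighted integral of
  \<open>?K - m1\<close> at most 0. The weight \<open>D\<close> is decreasing, as \<open>q\<close>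
  increases, so minimality of \<open>k\<close> makes the weighted integral of \<open>?K - m2\<close>
  at least 0. The gap between the levels forces the weight to vanish almost everywhere.\<close>

lemma first_order_projection:
  assumes M: "multipliers q a b" "0 < a" "0 < b" and q: "admissible q"
    and cont: "\<And>u. u \<in> {0<..<1} \<Longrightarrow> continuous (at_left u) q"
    and s\<Phi>: "square_integrable \<Phi>" and s\<gamma>: "square_integrable \<gamma>"
    and k: "isotonic_min (\<lambda>u. \<Phi> u + a / b * \<gamma> u) k" and u: "u \<in> {0<..<1}"
  shows "d (q u) = k u"
proof -
  let ?K = "\<lambda>u. \<Phi> u + a / b * \<gamma> u"
  have sK: "square_integrable ?K" by (intro square_integrable_add square_integrable_cmult s\<Phi> s\<gamma>)
  have kc: "k \<in> isotonic_cone" using k unfolding isotonic_min_def by simp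
  note kD = isotonic_coneD[OF kc]
  have mono_q: "mono_on {0<..<1} q" using q unfolding admissible_def by simp
  have [measurable]: "q \<in> borel_measurable unif" by (rule admissible_measurable[OF q])
  have [measurable]: "k \<in> borel_measurable unif" using kD(3) unfolding square_integrable_def by simp
  have fac: "a * \<gamma> v + b * (\<Phi> v - m) = b * (?K v - m)" for v m
    using M(3) by (simp add: field_simps)
  have IN: "integrable unif (\<lambda>u. \<bar>m\<bar> + \<bar>\<Phi> u\<bar>)" for m
    using square_integrable_integrable[OF s\<Phi>] by simp
  have near: "\<forall>\<^sub>F v in at_left u. v \<in> {0<..<u}" by (rule eventually_at_left_real) (use u in simp)
  have "\<not> d (q u) < k u"
  proof
    assume "d (q u) < k u"
    then obtain m2 where m2: "d (q u) < m2" "m2 < k u" using dense by blast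
    then obtain m1 where m1: "d (q u) < m1" "m1 < m2" using dense by blast
    define c where "c = \<psi> m1"
    have qc: "q u < c" using m1(1) d_less_iff[of "q u" c] by (simp add: c_def)
    define A where "A = {v \<in> {0<..<1}. m2 < k v}"
    define D where "D v = min (max 0 (c - q v)) 1" for v
    let ?w = "\<lambda>v. if v \<in> A then min (max 0 (c - q v)) 1 else 0"
    have w: "?w v = of_bool (m2 < k v) * D v" if "v \<in> {0<..<1}" for v
      using that by (simp add: A_def D_def)
    have [measurable]: "D \<in> borel_measurable unif" unfolding D_def by measurable
    have wb: "\<bar>of_bool (m2 < k v) * D v\<bar> \<le> 1" for v by (auto simp: D_def)
    have Iw: "integrable unif (\<lambda>v. of_bool (m2 < k v) * D v)"
      using wb by (intro unif.integrable_const_bound[where B = 1]) auto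
    have I: "integrable unif (\<lambda>v. of_bool (m2 < k v) * D v * (?K v - m))" for m
      using integrable_mult_bounded[OF square_integrable_integrable[OF
            square_integrable_diff[OF sK square_integrable_const[of m]]] _ wb]
      by (simp add: mult.commute)
    have "(\<integral>v. b * (of_bool (m2 < k v) * D v * (?K v - m1)) \<partial>unif) \<le> 0"
    proof (rule raise_variation[OF M(1) q, where A = A and c = c])
      show "v \<in> A" if "u \<in> A" "u \<le> v" "v < 1" for u v
        using that mono_onD[OF kD(1), of u v] by (auto simp: A_def)
      show "integrable unif (\<lambda>u. \<bar>d c\<bar> + \<bar>\<Phi> u\<bar>)" by (rule IN)
      show "integrable unif (\<lambda>v. b * (of_bool (m2 < k v) * D v * (?K v - m1)))" using I by simp
      show "AE v in unif. b * (of_bool (m2 < k v) * D v * (?K v - m1)) \<le> (a * \<gamma> v + b * (\<Phi> v - d c)) * ?w v"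
        unfolding fac by (intro AE_I2) (simp only: space_unif w, simp add: c_def mult_ac)
    qed auto
    then have "(\<integral>v. of_bool (m2 < k v) * D v * (?K v - m1) \<partial>unif) \<le> 0"
      using M(3) by (simp add: mult_le_0_iff)
    moreover have "0 \<le> (\<integral>v. of_bool (m2 < k v) * D v * (?K v - m2) \<partial>unif)"
    proof (rule isotonic_min_level_upper[OF sK k])
      show "D v \<le> D u" if "u \<in> {0<..<1}" "v \<in> {0<..<1}" "u \<le> v" for u v
        using mono_onD[OF mono_q that] by (auto simp: D_def min_def max_def)
      show "continuous (at_left v) D" if "v \<in> {0<..<1}" for v
        unfolding D_def using cont[OF that] by (intro continuous_intros)
    qed (auto simp: D_def)
    moreover have "(\<integral>v. of_bool (m2 < k v) * D v * (?K v - m1) \<partial>unif)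
        = (\<integral>v. of_bool (m2 < k v) * D v * (?K v - m2) \<partial>unif) + (m2 - m1) * (\<integral>v. of_bool (m2 < k v) * D v \<partial>unif)"
    proof -
      have "(\<integral>v. of_bool (m2 < k v) * D v * (?K v - m1) \<partial>unif)
        = (\<integral>v. of_bool (m2 < k v) * D v * (?K v - m2) + (m2 - m1) * (of_bool (m2 < k v) * D v) \<partial>unif)"
        by (rule Bochner_Integration.integral_cong) (simp_all add: algebra_simps)
      then show ?thesis
        using Bochner_Integration.integral_add[OF I[of m2] integrable_mult_right[OF Iw, of "m2 - m1"]] by simp
    qed
    ultimately have "(m2 - m1) * (\<integral>v. of_bool (m2 < k v) * D v \<partial>unif) \<le> 0" by linarith
    then have "(\<integral>v. of_bool (m2 < k v) * D v \<partial>unif) \<le> 0"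
      using m1(2) by (simp add: mult_le_0_iff)
    then have AE: "AE v in unif. of_bool (m2 < k v) * D v = 0"
      by (intro integral_nonpos_imp_AE_0 Iw) (auto simp: D_def)
    have "\<forall>\<^sub>F v in at_left u. m2 < k v"
      using kD(2)[OF u] m2(2) unfolding continuous_within by (rule order_tendstoD(1))
    then obtain y where y: "y < u" "\<And>v. y < v \<Longrightarrow> v < u \<Longrightarrow> m2 < k v"
      unfolding eventually_at_left_field by auto
    \<comment> \<open>Just left of \<open>u\<close> the weight is positive: \<open>k\<close> exceeds
      \<open>m2\<close> by left continuity, and \<open>q\<close> stays below \<open>c\<close> by
      monotonicity.\<close>
    obtain v where v: "max y 0 < v" "v < u" "of_bool (m2 < k v) * D v = 0"
      using AE_unif_interval[OF AE, of "max y 0" u] u y(1) by auto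
    have "q v \<le> q u" using mono_onD[OF mono_q, of v u] u v by auto
    then show False using v y(2)[of v] qc by (auto simp: D_def min_def max_def split: if_splits)
  qed
  moreover have "\<not> k u < d (q u)"
  proof
    assume "k u < d (q u)"
    then obtain m2 where m2: "k u < m2" "m2 < d (q u)" using dense by blast
    then obtain m1 where m1: "m2 < m1" "m1 < d (q u)" using dense by blast
    \<comment> \<open>The mirror image: \<open>q\<close> is lowered towards \<open>\<psi> m1\<close>
      on \<open>{k < m2}\<close>, now with \<open>m2 < m1\<close>, and the weight is
      increasing.\<close>
    define c where "c = \<psi> m1"
    have qc: "c < q u" using m1(2) d_less_iff[of c "q u"] by (simp add: c_def)
    define A where "A = {v \<in> {0<..<1}. k v < m2}"
    define D where "D v = min (max 0 (q v - c)) 1" for v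
    let ?w = "\<lambda>v. if v \<in> A then min (max 0 (q v - c)) 1 else 0"
    have w: "?w v = of_bool (k v < m2) * D v" if "v \<in> {0<..<1}" for v
      using that by (simp add: A_def D_def)
    have [measurable]: "D \<in> borel_measurable unif" unfolding D_def by measurable
    have wb: "\<bar>of_bool (k v < m2) * D v\<bar> \<le> 1" for v by (auto simp: D_def)
    have Iw: "integrable unif (\<lambda>v. of_bool (k v < m2) * D v)"
      using wb by (intro unif.integrable_const_bound[where B = 1]) auto
    have I: "integrable unif (\<lambda>v. of_bool (k v < m2) * D v * (m - ?K v))" for m
      using integrable_mult_bounded[OF square_integrable_integrable[OF
            square_integrable_diff[OF square_integrable_const[of m] sK]] _ wb]
      by (simp add: mult.commute)
    have "(\<integral>v. b * (of_bool (k v < m2) * D v * (m1 - ?K v)) \<partial>unif) \<le> 0"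
    proof (rule lower_variation[OF M(1) q, where A = A and c = c])
      show "u \<in> A" if "v \<in> A" "u \<le> v" "0 < u" for u v
        using that mono_onD[OF kD(1), of u v] by (auto simp: A_def)
      show "integrable unif (\<lambda>u. \<bar>d c\<bar> + \<bar>\<Phi> u\<bar>)" by (rule IN)
      show "integrable unif (\<lambda>v. b * (of_bool (k v < m2) * D v * (m1 - ?K v)))" using I by simp
      show "AE v in unif. b * (of_bool (k v < m2) * D v * (m1 - ?K v)) \<le> - (a * \<gamma> v + b * (\<Phi> v - d c)) * ?w v"
        unfolding fac by (intro AE_I2) (simp only: space_unif w, simp add: c_def algebra_simps)
    qed auto
    then have "(\<integral>v. of_bool (k v < m2) * D v * (m1 - ?K v) \<partial>unif) \<le> 0"
      using M(3) by (simp add: mult_le_0_iff)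
    moreover have "0 \<le> (\<integral>v. of_bool (k v < m2) * D v * (m2 - ?K v) \<partial>unif)"
    proof (rule isotonic_min_level_lower[OF sK k])
      show "mono_on {0<..<1} D"
        using mono_onD[OF mono_q] by (intro mono_onI) (fastforce simp: D_def min_def max_def)
      show "continuous (at_left v) D" if "v \<in> {0<..<1}" for v
        unfolding D_def using cont[OF that] by (intro continuous_intros)
    qed (auto simp: D_def)
    moreover have "(\<integral>v. of_bool (k v < m2) * D v * (m1 - ?K v) \<partial>unif)
        = (\<integral>v. of_bool (k v < m2) * D v * (m2 - ?K v) \<partial>unif) + (m1 - m2) * (\<integral>v. of_bool (k v < m2) * D v \<partial>unif)"
    proof -
      have "(\<integral>v. of_bool (k v < m2) * D v * (m1 - ?K v) \<partial>unif)
        = (\<integral>v. of_bool (k v < m2) * D v * (m2 - ?K v) + (m1 - m2) * (of_bool (k v < m2) * D v) \<partial>unif)"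
        by (rule Bochner_Integration.integral_cong) (simp_all add: algebra_simps)
      then show ?thesis
        using Bochner_Integration.integral_add[OF I[of m2] integrable_mult_right[OF Iw, of "m1 - m2"]] by simp
    qed
    ultimately have "(m1 - m2) * (\<integral>v. of_bool (k v < m2) * D v \<partial>unif) \<le> 0" by linarith
    then have "(\<integral>v. of_bool (k v < m2) * D v \<partial>unif) \<le> 0"
      using m1(1) by (simp add: mult_le_0_iff)
    then have AE: "AE v in unif. of_bool (k v < m2) * D v = 0"
      by (intro integral_nonpos_imp_AE_0 Iw) (auto simp: D_def)
    have "\<forall>\<^sub>F v in at_left u. c < q v"
      using cont[OF u] qc unfolding continuous_within by (rule order_tendstoD(1))
    then obtain y where y: "y < u" "\<And>v. y < v \<Longrightarrow> v < u \<Longrightarrow> c < q v"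
      unfolding eventually_at_left_field by auto
    \<comment> \<open>The roles are exchanged: here left continuity of \<open>q\<close> and
      monotonicity of \<open>k\<close> make the weight positive.\<close>
    obtain v where v: "max y 0 < v" "v < u" "of_bool (k v < m2) * D v = 0"
      using AE_unif_interval[OF AE, of "max y 0" u] u y(1) by auto
    have "k v \<le> k u" using mono_onD[OF kD(1), of v u] u v by auto
    then show False using v y(2)[of v] m2(1) by (auto simp: D_def min_def max_def split: if_splits)
  qed
  ultimately show ?thesis by simp
qed

text \<open>Existence of the multiplier is stationarity of \<open>q\<close>. For its uniqueness,
  projection preserves order, so a smaller multiplier places the candidate further above
  \<open>f\<close>; equal divergences then force equal projections.\<close>

lemma worst_case_proj:
  assumes q: "worst q" and nn: "\<forall>u\<in>{0<..<1}. 0 \<le> \<gamma> u"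
    and s\<Phi>: "square_integrable \<Phi>" and s\<gamma>: "square_integrable \<gamma>"
  shows "\<exists>lam>0. bw_div \<phi> (cand_proj \<phi> F \<gamma> lam) f = ennreal \<epsilon> \<and>
           (\<forall>\<mu>>0. bw_div \<phi> (cand_proj \<phi> F \<gamma> \<mu>) f = ennreal \<epsilon> \<longrightarrow> \<mu> = lam) \<and>
           (\<forall>u\<in>{0<..<1}. q u = cand_proj \<phi> F \<gamma> lam u)"
proof -
  note fq = worst_feasible[OF q]
  have ad: "admissible q" by (rule feasible_admissible(1)[OF fq])
  have cont: "continuous (at_left u) q" if "u \<in> {0<..<1}" for u
    using fq quantile_continuous_at_left[OF moment_cdfs_is_cdf that] unfolding feasible_def by auto
  obtain a b where M: "multipliers q a b" and ab: "0 < a" "0 < b" and div: "divg q = \<epsilon>"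
    using multipliers_pos[OF q disjI2] nn s\<Phi> by blast
  define k where "k \<mu> = isotonic_proj (tilted \<phi> F \<gamma> \<mu>)" for \<mu>
  let ?c = "cand_proj \<phi> F \<gamma>"
  have c: "?c \<mu> u = \<psi> (k \<mu> u)" for \<mu> u by (simp add: cand_proj_def k_def)
  have tilted: "tilted \<phi> F \<gamma> \<mu> = (\<lambda>u. \<Phi> u + 1 / \<mu> * \<gamma> u)" for \<mu>
    by (simp add: tilted_def fun_eq_iff)
  have st: "square_integrable (tilted \<phi> F \<gamma> \<mu>)" for \<mu>
    unfolding tilted by (intro square_integrable_add square_integrable_cmult s\<Phi> s\<gamma>)
  have k: "isotonic_min (tilted \<phi> F \<gamma> \<mu>) (k \<mu>)" for \<mu>
    unfolding k_def by (rule isotonic_min_proj[OF st])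
  have k_meas [measurable]: "k \<mu> \<in> borel_measurable unif" for \<mu>
    using k[of \<mu>] isotonic_cone_square_integrable unfolding isotonic_min_def square_integrable_def by blast
  define lam where "lam = b / a"
  have lam: "0 < lam" using ab by (simp add: lam_def)
  have eq: "q u = ?c lam u" if "u \<in> {0<..<1}" for u
  proof -
    have "isotonic_min (\<lambda>u. \<Phi> u + a / b * \<gamma> u) (k lam)"
      using k[of lam] by (simp add: tilted lam_def)
    then have "d (q u) = k lam u"
      using first_order_projection[OF M ab ad cont s\<Phi> s\<gamma> _ that] by blast
    then show ?thesis unfolding c by (metis \<psi>_d)
  qed
  have "bw_div \<phi> (?c lam) f = bw_div \<phi> q f"
    unfolding bw_div_def using eq by (intro nn_integral_cong) simp
  also have "\<dots> = ennreal \<epsilon>" using bw_div_eq_divg[of q] ad div unfolding admissible_def by simp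
  finally have lam_div: "bw_div \<phi> (?c lam) f = ennreal \<epsilon>" .
  have I: "integrable unif (\<lambda>u. bregman \<phi> (?c \<nu> u) (f u))" "divg (?c \<nu>) = \<epsilon>"
    if "bw_div \<phi> (?c \<nu>) f = ennreal \<epsilon>" for \<nu>
  proof -
    have "?c \<nu> \<in> borel_measurable unif" unfolding c by measurable
    then show I: "integrable unif (\<lambda>u. bregman \<phi> (?c \<nu> u) (f u))"
      using that by (intro integrable_bregmanI) simp_all
    show "divg (?c \<nu>) = \<epsilon>" using bw_div_eq_divg[OF I] that divg_nonneg eps by simp
  qed
  have strict: False
    if \<mu>: "0 < \<mu>" "\<mu> < \<nu>" "bw_div \<phi> (?c \<mu>) f = ennreal \<epsilon>" "bw_div \<phi> (?c \<nu>) f = ennreal \<epsilon>" for \<mu> \<nu>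
  proof -
    have inv: "1 / \<nu> < 1 / \<mu>" using \<mu>(1,2) by (simp add: frac_less2)
    have "AE u in unif. tilted \<phi> F \<gamma> \<nu> u \<le> tilted \<phi> F \<gamma> \<mu> u"
      using nn less_imp_le[OF inv] unfolding tilted by (intro AE_I2 add_left_mono mult_right_mono) auto
    then have 1: "AE u in unif. k \<nu> u \<le> k \<mu> u" by (rule isotonic_min_mono[OF st st _ k k])
    have "AE u in unif. \<Phi> u \<le> tilted \<phi> F \<gamma> \<nu> u"
      using nn \<mu> unfolding tilted by (intro AE_I2) auto
    then have 2: "AE u in unif. \<Phi> u \<le> k \<nu> u"
      by (rule isotonic_min_mono[OF s\<Phi> st _ isotonic_min_deriv_quantile[OF s\<Phi>] k])
    let ?e = "\<lambda>u. bregman \<phi> (?c \<mu> u) (f u) - bregman \<phi> (?c \<nu> u) (f u)"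
    have pos: "0 < ?e u" if "\<Phi> u \<le> k \<nu> u" "k \<nu> u < k \<mu> u" for u
    proof -
      have "\<psi> (\<Phi> u) \<le> ?c \<nu> u" "?c \<nu> u < ?c \<mu> u"
        using that unfolding c \<psi>_le_iff \<psi>_less_iff by auto
      then show ?thesis using bregman_mono_right[of "f u" "?c \<nu> u" "?c \<mu> u"] by simp
    qed
    have zero: "?e u = 0" if "k \<nu> u = k \<mu> u" for u using that by (simp add: c)
    have Ie: "integrable unif ?e" using I[OF \<mu>(3)] I[OF \<mu>(4)] by simp
    have nne: "AE u in unif. 0 \<le> ?e u"
      using 1 2
    proof eventually_elim
      case (elim u)
      then show ?case using pos[of u] zero[of u] by (cases "k \<nu> u = k \<mu> u") auto
    qed
    have "(\<integral>u. ?e u \<partial>unif) = 0" using I[OF \<mu>(3)] I[OF \<mu>(4)] unfolding divg_def by simp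
    then have "AE u in unif. ?e u = 0" using integral_nonneg_eq_0_iff_AE[OF Ie nne] by simp
    then have "AE u in unif. k \<mu> u = k \<nu> u"
      using 1 2
    proof eventually_elim
      case (elim u)
      then show ?case using pos[of u] by force
    qed
    then have "(\<integral>u. k \<mu> u \<partial>unif) = (\<integral>u. k \<nu> u \<partial>unif)"
      by (intro integral_cong_AE) auto
    \<comment> \<open>Equal projections need not come from equal functions, but they have equal
      means. This reduces the comparison to the mean of \<open>\<gamma>\<close>, which a
      non-negative, non-trivial weight has positive.\<close>
    then have "(\<integral>u. tilted \<phi> F \<gamma> \<mu> u \<partial>unif) = (\<integral>u. tilted \<phi> F \<gamma> \<nu> u \<partial>unif)"
      using isotonic_min_mean[OF st k] by simp
    then have "1 / \<mu> * (\<integral>u. \<gamma> u \<partial>unif) = 1 / \<nu> * (\<integral>u. \<gamma> u \<partial>unif)"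
      unfolding tilted using square_integrable_integrable[OF s\<Phi>] gamma_integrable
      by (simp add: Bochner_Integration.integral_add)
    then have "(\<integral>u. \<gamma> u \<partial>unif) = 0" using inv by (auto simp: mult_cancel_right)
    then have "AE u in unif. \<gamma> u = 0"
      using nn by (intro integral_nonpos_imp_AE_0 gamma_integrable) auto
    then show False using gamma_nontrivial by simp
  qed
  have "\<mu> = lam" if "0 < \<mu>" "bw_div \<phi> (?c \<mu>) f = ennreal \<epsilon>" for \<mu>
    using strict[of \<mu> lam] strict[of lam \<mu>] that lam lam_div by (cases \<mu> lam rule: linorder_cases) auto
  then show ?thesis using lam lam_div eq by blast
qed

end

theorem theorem6:
  fixes h \<gamma> \<phi> F q :: "real \<Rightarrow> real" and p \<epsilon> :: real
  assumes p: "p \<ge> 1"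
    and h: "distortion h" "distortion_weight h \<gamma>" "weight_representation p h \<gamma>"
    and phi: "strict_bregman_generator \<phi>"
      "filterlim (deriv \<phi>) at_top at_top" "filterlim (deriv \<phi>) at_bot at_bot"
    and F: "is_cdf F"
    and eps: "\<epsilon> > 0"
    and fin: "\<And>q. feasible p \<phi> F \<epsilon> q \<Longrightarrow> choquet_finite h unif q"
    and cases:
      "mono_on {0<..<1} \<gamma> \<or>
       (\<forall>u\<in>{0<..<1}. \<gamma> u \<ge> 0) \<and>
         (\<integral>\<^sup>+u. ennreal ((deriv \<phi> (quantile F u))\<^sup>2 + (\<gamma> u)\<^sup>2) \<partial>unif) < \<infinity>"
    and worst: "worst_case_quantile p h \<phi> F \<epsilon> q"
  shows
    "(\<forall>q'. worst_case_quantile p h \<phi> F \<epsilon> q' \<longrightarrow> (\<forall>u\<in>{0<..<1}. q' u = q u)) \<and>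
     (mono_on {0<..<1} \<gamma> \<longrightarrow>
        (\<exists>lam>0. bw_div \<phi> (cand_mono \<phi> F \<gamma> lam) (quantile F) = ennreal \<epsilon> \<and>
           (\<forall>\<mu>>0. bw_div \<phi> (cand_mono \<phi> F \<gamma> \<mu>) (quantile F) = ennreal \<epsilon> \<longrightarrow> lam \<le> \<mu>) \<and>
           (AE u in unif. q u = cand_mono \<phi> F \<gamma> lam u))) \<and>
     ((\<forall>u\<in>{0<..<1}. \<gamma> u \<ge> 0) \<and>
         (\<integral>\<^sup>+u. ennreal ((deriv \<phi> (quantile F u))\<^sup>2 + (\<gamma> u)\<^sup>2) \<partial>unif) < \<infinity> \<longrightarrow>
        (\<exists>lam>0. bw_div \<phi> (cand_proj \<phi> F \<gamma> lam) (quantile F) = ennreal \<epsilon> \<and>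
           (\<forall>\<mu>>0. bw_div \<phi> (cand_proj \<phi> F \<gamma> \<mu>) (quantile F) = ennreal \<epsilon> \<longrightarrow> \<mu> = lam) \<and>
           (\<forall>u\<in>{0<..<1}. q u = cand_proj \<phi> F \<gamma> lam u)))"
proof -
  have h0: "h 0 = 0" using h(1) by (simp add: distortion_def)
  interpret worst_case_problem \<phi> h \<gamma> F p \<epsilon>
    by unfold_locales
      (fact p h phi F eps fin weight_integrable[OF h(3) h0] weight_nontrivial[OF h(3) h(1)])+
  have sq: "square_integrable \<Phi>" "square_integrable \<gamma>"
    if "(\<integral>\<^sup>+u. ennreal ((d (f u))\<^sup>2 + (\<gamma> u)\<^sup>2) \<partial>unif) < \<infinity>"
  proof -
    have I: "integrable unif (\<lambda>u. (\<Phi> u)\<^sup>2 + (\<gamma> u)\<^sup>2)"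
      by (rule integrableI_nonneg) (use that in auto)
    have "integrable unif (\<lambda>u. (\<Phi> u)\<^sup>2)" "integrable unif (\<lambda>u. (\<gamma> u)\<^sup>2)"
      by (rule Bochner_Integration.integrable_bound[OF I]; simp)+
    then show "square_integrable \<Phi>" "square_integrable \<gamma>"
      unfolding square_integrable_def by simp_all
  qed
  have cases': "mono_on {0<..<1} \<gamma> \<or> (\<forall>u\<in>{0<..<1}. 0 \<le> \<gamma> u) \<and> square_integrable \<Phi>"
    using cases sq(1) by blast
  show ?thesis
    using worst_unique[OF worst _ cases'] worst_case_mono[OF worst] worst_case_proj[OF worst _ sq] by blast
qed

end
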